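(* Let $p\in(0,\infty)$ with $p\neq2$, let $\mathfrak N$ be a $\mathrm{II}_1$ factor, and let $\psi$ be a surjective $L^p$-isometry on $\mathscr U(\mathfrak N)$. If $\psi(U)=U$ for every self-adjoint unitary $U\in\mathfrak N$ and $\psi(e^{i\theta}I)=e^{i\theta}I$ for every $\theta\in\mathbb R$, then $\psi(e^{i\theta}U)=e^{i\theta}U$ for every self-adjoint unitary $U\in\mathfrak N$ and every $\theta\in\mathbb R$.
   Context: $\mathscr U(\mathfrak N)$ is the unitary group of $\mathfrak N$; with $\tau$ the tracial state of $\mathfrak N$, $\|A\|_p:=\tau(|A|^p)^{1/p}$. A map $\psi:\mathscr U(\mathfrak N)\to\mathscr U(\mathfrak N)$ is an $L^p$-isometry if $\|U-V\|_p=\|\psi(U)-\psi(V)\|_p$ for all $U,V\in\mathscr U(\mathfrak N)$. *)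

theory Defs
  imports "HOL-Analysis.Analysis" "HOL-Computational_Algebra.Polynomial"
begin

section \<open>Complex Hilbert spaces\<close>

text \<open>
  The library provides real inner product spaces only. A complex Hilbert space is a complete real
  inner product space with a compatible complex structure: the given real inner product is the
  real part of the complex one, so that the library's \<^const>\<open>norm\<close> is the Hilbert space norm.
  Positive definiteness of \<open>cinner\<close> follows from that of \<^const>\<open>inner\<close>.
\<close>

class chilbert_space = real_inner + complete_space +
  fixes scaleC :: "complex \<Rightarrow> 'a \<Rightarrow> 'a"
    and cinner :: "'a \<Rightarrow> 'a \<Rightarrow> complex"
  assumes scaleC_add_right: "scaleC c (x + y) = scaleC c x + scaleC c y"
    and scaleC_add_left: "scaleC (c + d) x = scaleC c x + scaleC d x"
    and scaleC_scaleC: "scaleC c (scaleC d x) = scaleC (c * d) x"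
    and scaleC_of_real: "scaleC (complex_of_real r) x = r *\<^sub>R x"
    and cinner_commute: "cinner x y = cnj (cinner y x)"
    and cinner_add_left: "cinner (x + y) z = cinner x z + cinner y z"
    and cinner_scaleC_left: "cinner (scaleC c x) y = c * cinner x y"
    and inner_eq_Re_cinner: "inner x y = Re (cinner x y)"

lemma norm_scaleC:
  fixes x :: "'h::chilbert_space"
  shows "norm (scaleC c x) = cmod c * norm x"
proof -
  have im: "Im (cinner x x) = 0"
    using cinner_commute[of x x] by (simp add: complex_eq_iff)
  have r: "cinner y (scaleC c z) = cnj c * cinner y z" for y z :: 'h
    by (metis cinner_commute cinner_scaleC_left complex_cnj_mult)
  have "inner (scaleC c x) (scaleC c x) = Re (c * cnj c * cinner x x)"
    by (simp add: inner_eq_Re_cinner cinner_scaleC_left r algebra_simps)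
  also have "\<dots> = (cmod c)\<^sup>2 * inner x x"
    unfolding cmod_power2 by (simp add: inner_eq_Re_cinner im power2_eq_square algebra_simps)
  finally show ?thesis
    by (simp add: norm_eq_sqrt_inner real_sqrt_mult)
qed


section \<open>Bounded operators\<close>

text \<open>
  Operators are taken from the library's type of bounded real-linear maps. \<open>clinear_ops\<close> is
  $B(H)$.
\<close>

definition clinear_ops :: "('h::chilbert_space \<Rightarrow>\<^sub>L 'h) set" where
  "clinear_ops = {A. \<forall>c x. blinfun_apply A (scaleC c x) = scaleC c (blinfun_apply A x)}"

lift_definition cscale :: "complex \<Rightarrow> ('h::chilbert_space \<Rightarrow>\<^sub>L 'h) \<Rightarrow> ('h \<Rightarrow>\<^sub>L 'h)" is
  "\<lambda>c f x. scaleC c (f x)"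
proof -
  fix c :: complex and f :: "'h \<Rightarrow> 'h"
  assume f: "bounded_linear f"
  have "bounded_linear (scaleC c :: 'h \<Rightarrow> 'h)"
  proof (rule bounded_linear_intro)
    show "scaleC c (r *\<^sub>R x) = r *\<^sub>R scaleC c x" for r and x :: 'h
      by (simp flip: scaleC_of_real add: scaleC_scaleC mult.commute)
    show "norm (scaleC c x) \<le> norm x * cmod c" for x :: 'h
      by (simp add: norm_scaleC)
  qed (rule scaleC_add_right)
  then show "bounded_linear (\<lambda>x. scaleC c (f x))"
    using f by (rule bounded_linear_compose)
qed

definition adj :: "('h::chilbert_space \<Rightarrow>\<^sub>L 'h) \<Rightarrow> ('h \<Rightarrow>\<^sub>L 'h)" where
  "adj A = (THE B. \<forall>x y. cinner (blinfun_apply A x) y = cinner x (blinfun_apply B y))"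

definition op_pow :: "('h::chilbert_space \<Rightarrow>\<^sub>L 'h) \<Rightarrow> nat \<Rightarrow> ('h \<Rightarrow>\<^sub>L 'h)" where
  "op_pow A n = ((\<lambda>B. A o\<^sub>L B) ^^ n) id_blinfun"

definition op_poly :: "real poly \<Rightarrow> ('h::chilbert_space \<Rightarrow>\<^sub>L 'h) \<Rightarrow> ('h \<Rightarrow>\<^sub>L 'h)" where
  "op_poly q A = (\<Sum>i\<le>degree q. coeff q i *\<^sub>R op_pow A i)"

definition spectrum :: "('h::chilbert_space \<Rightarrow>\<^sub>L 'h) \<Rightarrow> complex set" where
  "spectrum A = {z. \<not> (\<exists>B \<in> clinear_ops.
      B o\<^sub>L (A - cscale z id_blinfun) = id_blinfun \<and>
      (A - cscale z id_blinfun) o\<^sub>L B = id_blinfun)}"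

text \<open>
  Continuous functional calculus of a self-adjoint operator \<open>A\<close>: \<open>cfc f A\<close> is the norm limit
  of \<open>q\<^sub>n(A)\<close> for every sequence of polynomials \<open>q\<^sub>n\<close> converging to \<open>f\<close> uniformly on the
  (real) spectrum of \<open>A\<close>. For continuous \<open>f\<close> such sequences exist, and the limit does not depend
  on the sequence. The value is meaningless if \<open>A\<close> is not self-adjoint.
\<close>

definition cfc :: "(real \<Rightarrow> real) \<Rightarrow> ('h::chilbert_space \<Rightarrow>\<^sub>L 'h) \<Rightarrow> ('h \<Rightarrow>\<^sub>L 'h)" where
  "cfc f A = (THE B. \<forall>q :: nat \<Rightarrow> real poly.
      uniform_limit {t. complex_of_real t \<in> spectrum A} (\<lambda>n t. poly (q n) t) f sequentially
      \<longrightarrow> (\<lambda>n. op_poly (q n) A) \<longlonglongrightarrow> B)"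

definition op_abs :: "('h::chilbert_space \<Rightarrow>\<^sub>L 'h) \<Rightarrow> ('h \<Rightarrow>\<^sub>L 'h)" where
  "op_abs A = cfc sqrt (adj A o\<^sub>L A)"

text \<open>For positive \<open>A\<close> and \<open>p > 0\<close>; note that \<open>0 powr p = 0\<close>.\<close>

definition op_powr :: "('h::chilbert_space \<Rightarrow>\<^sub>L 'h) \<Rightarrow> real \<Rightarrow> ('h \<Rightarrow>\<^sub>L 'h)" where
  "op_powr A p = cfc (\<lambda>t. t powr p) A"


section \<open>Von Neumann algebras and \<open>II\<^sub>1\<close> factors\<close>

definition commutant :: "('h::chilbert_space \<Rightarrow>\<^sub>L 'h) set \<Rightarrow> ('h \<Rightarrow>\<^sub>L 'h) set" where
  "commutant S = {B \<in> clinear_ops. \<forall>A\<in>S. A o\<^sub>L B = B o\<^sub>L A}"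

text \<open>
  A self-adjoint set of operators that equals its double commutant; being a unital algebra is
  automatic.
\<close>

definition von_neumann_algebra :: "('h::chilbert_space \<Rightarrow>\<^sub>L 'h) set \<Rightarrow> bool" where
  "von_neumann_algebra N \<longleftrightarrow>
     N \<subseteq> clinear_ops \<and> (\<forall>A\<in>N. adj A \<in> N) \<and> commutant (commutant N) = N"

definition is_factor :: "('h::chilbert_space \<Rightarrow>\<^sub>L 'h) set \<Rightarrow> bool" where
  "is_factor N \<longleftrightarrow> von_neumann_algebra N \<and> (id_blinfun :: 'h \<Rightarrow>\<^sub>L 'h) \<noteq> 0 \<and>
     N \<inter> commutant N = range (\<lambda>c. cscale c id_blinfun)"

definition projections :: "('h::chilbert_space \<Rightarrow>\<^sub>L 'h) set \<Rightarrow> ('h \<Rightarrow>\<^sub>L 'h) set" where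
  "projections N = {P \<in> N. adj P = P \<and> P o\<^sub>L P = P}"

definition subprojection :: "('h::chilbert_space \<Rightarrow>\<^sub>L 'h) \<Rightarrow> ('h \<Rightarrow>\<^sub>L 'h) \<Rightarrow> bool" where
  "subprojection Q P \<longleftrightarrow> P o\<^sub>L Q = Q"

definition mvn_equivalent ::
    "('h::chilbert_space \<Rightarrow>\<^sub>L 'h) set \<Rightarrow> ('h \<Rightarrow>\<^sub>L 'h) \<Rightarrow> ('h \<Rightarrow>\<^sub>L 'h) \<Rightarrow> bool" where
  "mvn_equivalent N P Q \<longleftrightarrow> (\<exists>V\<in>N. adj V o\<^sub>L V = P \<and> V o\<^sub>L adj V = Q)"

definition finite_projection ::
    "('h::chilbert_space \<Rightarrow>\<^sub>L 'h) set \<Rightarrow> ('h \<Rightarrow>\<^sub>L 'h) \<Rightarrow> bool" where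
  "finite_projection N P \<longleftrightarrow> P \<in> projections N \<and>
     (\<forall>Q\<in>projections N. subprojection Q P \<and> mvn_equivalent N P Q \<longrightarrow> Q = P)"

definition minimal_projection ::
    "('h::chilbert_space \<Rightarrow>\<^sub>L 'h) set \<Rightarrow> ('h \<Rightarrow>\<^sub>L 'h) \<Rightarrow> bool" where
  "minimal_projection N P \<longleftrightarrow> P \<in> projections N \<and> P \<noteq> 0 \<and>
     (\<forall>Q\<in>projections N. subprojection Q P \<longrightarrow> Q = 0 \<or> Q = P)"

definition II1_factor :: "('h::chilbert_space \<Rightarrow>\<^sub>L 'h) set \<Rightarrow> bool" where
  "II1_factor N \<longleftrightarrow> is_factor N \<and> finite_projection N id_blinfun \<and>
     \<not> (\<exists>P. minimal_projection N P)"

text \<open>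
  Every \<open>II\<^sub>1\<close> factor has exactly one tracial state, and that state is faithful (and normal).
  Hence on a \<open>II\<^sub>1\<close> factor \<open>N\<close> the following predicate singles out the tracial state of \<open>N\<close>;
  values of \<open>\<tau>\<close> outside \<open>N\<close> are irrelevant.
\<close>

definition tracial_state ::
    "('h::chilbert_space \<Rightarrow>\<^sub>L 'h) set \<Rightarrow> (('h \<Rightarrow>\<^sub>L 'h) \<Rightarrow> complex) \<Rightarrow> bool" where
  "tracial_state N \<tau> \<longleftrightarrow>
     (\<forall>A\<in>N. \<forall>B\<in>N. \<tau> (A + B) = \<tau> A + \<tau> B) \<and>
     (\<forall>c. \<forall>A\<in>N. \<tau> (cscale c A) = c * \<tau> A) \<and>
     (\<forall>A\<in>N. \<tau> (adj A o\<^sub>L A) \<in> \<real> \<and> 0 \<le> Re (\<tau> (adj A o\<^sub>L A))) \<and>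
     \<tau> id_blinfun = 1 \<and>
     (\<forall>A\<in>N. \<forall>B\<in>N. \<tau> (A o\<^sub>L B) = \<tau> (B o\<^sub>L A)) \<and>
     (\<forall>A\<in>N. \<tau> (adj A o\<^sub>L A) = 0 \<longrightarrow> A = 0)"

text \<open>\<open>\<tau>\<close> is real on positive operators, so taking the real part loses nothing.\<close>

definition Lp_norm ::
    "(('h::chilbert_space \<Rightarrow>\<^sub>L 'h) \<Rightarrow> complex) \<Rightarrow> real \<Rightarrow> ('h \<Rightarrow>\<^sub>L 'h) \<Rightarrow> real" where
  "Lp_norm \<tau> p A = Re (\<tau> (op_powr (op_abs A) p)) powr (1 / p)"

definition unitary_group :: "('h::chilbert_space \<Rightarrow>\<^sub>L 'h) set \<Rightarrow> ('h \<Rightarrow>\<^sub>L 'h) set" where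
  "unitary_group N = {U \<in> N. adj U o\<^sub>L U = id_blinfun \<and> U o\<^sub>L adj U = id_blinfun}"

definition Lp_isometry ::
    "('h::chilbert_space \<Rightarrow>\<^sub>L 'h) set \<Rightarrow> (('h \<Rightarrow>\<^sub>L 'h) \<Rightarrow> complex) \<Rightarrow> real \<Rightarrow>
     (('h \<Rightarrow>\<^sub>L 'h) \<Rightarrow> ('h \<Rightarrow>\<^sub>L 'h)) \<Rightarrow> bool" where
  "Lp_isometry N \<tau> p \<psi> \<longleftrightarrow>
     \<psi> \<in> unitary_group N \<rightarrow> unitary_group N \<and>
     (\<forall>U\<in>unitary_group N. \<forall>V\<in>unitary_group N.
        Lp_norm \<tau> p (U - V) = Lp_norm \<tau> p (\<psi> U - \<psi> V))"

end

theory Submission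
  imports Defs "HOL-Computational_Algebra.Fundamental_Theorem_Algebra"
begin

text \<open>
  Write \<open>q = p / 2\<close> and let \<open>U\<close> be a self-adjoint unitary, \<open>\<bar>\<alpha>\<bar> = 1\<close>, \<open>V = \<psi> (\<alpha> U)\<close> and
  \<open>Z = cnj \<alpha> V\<close>. Comparing with the scalars \<open>\<alpha>\<close> and \<open>- \<alpha>\<close> gives
  \<open>\<tau> (\<bar>Z - 1\<bar>\<^sup>p + \<bar>Z + 1\<bar>\<^sup>p) = 2\<^sup>p\<close>. Since \<open>\<bar>Z - 1\<bar>\<^sup>2 + \<bar>Z + 1\<bar>\<^sup>2 = 4\<close>, and
  \<open>s\<^sup>q + (1 - s)\<^sup>q = 1\<close> only at \<open>s = 0, 1\<close> on the unit interval, \<open>Z\<close> has spectrum in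
  \<open>{1, - 1}\<close>. Hence \<open>\<psi> (\<alpha> U) = \<alpha> W\<close> with \<open>W\<close> a self-adjoint unitary.

  To identify \<open>W\<close> with \<open>U\<close>, compare with some \<open>\<beta> U\<close> already known to be fixed: the p-norms of
  \<open>\<alpha> W - \<beta> U\<close> and \<open>\<alpha> U - \<beta> U\<close> agree. Jensen's inequality relates the former to
  \<open>\<tau> \<bar>\<alpha> W - \<beta> U\<bar>\<^sup>2 = 2 - 2 Re (\<alpha> cnj \<beta>) Re (\<tau> (U W))\<close>. It gives \<open>Re (\<tau> (U W)) \<ge> 1\<close>, hence
  \<open>W = U\<close>, if \<open>Re (\<alpha> cnj \<beta>)\<close> is negative for \<open>p < 2\<close> and positive for \<open>p > 2\<close>. One of
  \<open>\<beta> = 1, - 1\<close> works unless \<open>Re \<alpha> = 0\<close>; in that case some \<open>\<beta>\<close> with \<open>Re \<beta> \<noteq> 0\<close> does.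
\<close>

section \<open>Adjoints\<close>

lemma Lax_Milgram_square:
  fixes T :: "'a::{real_inner,complete_space} \<Rightarrow> 'a" and f :: "'a \<Rightarrow> real"
  assumes T: "bounded_linear T" and f: "bounded_linear f"
    and c: "c > 0" "\<And>x. norm (T x) \<ge> c * norm x"
  obtains u where "\<And>x. f x = inner (T x) (T u)"
proof -
  interpret T: bounded_linear T by fact
  interpret f: bounded_linear f by fact
  define J where "J x = (norm (T x))\<^sup>2 - 2 * f x" for x
  obtain K where K: "K > 0" "\<And>x. norm (f x) \<le> norm x * K"
    using f.pos_bounded by blast
  have J_ge: "J x \<ge> - (K / c)\<^sup>2" for x
  proof -
    have "f x \<le> norm x * K" using K(2)[of x] by simp
    also have "norm x * K \<le> norm (T x) * (K / c)"
      using c(2)[of x] c(1) K(1) by (simp add: field_simps)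
    finally have "f x \<le> norm (T x) * (K / c)" .
    moreover have "0 \<le> (norm (T x) - K / c)\<^sup>2" by simp
    ultimately show ?thesis
      unfolding J_def power2_diff by linarith
  qed
  define m where "m = Inf (range J)"
  have bdd: "bdd_below (range J)" by (rule bdd_belowI2) (rule J_ge)
  have m_le: "m \<le> J x" for x unfolding m_def using bdd by (auto intro: cInf_lower)
  have "\<exists>x. J x < m + 1 / real (Suc n)" for n
    using cInf_lessD[of "range J" "m + 1 / real (Suc n)"] by (auto simp: m_def)
  then obtain X where X: "\<And>n. J (X n) < m + 1 / real (Suc n)" by metis
  have par: "(norm (T (x - y)))\<^sup>2 \<le> 2 * J x + 2 * J y - 4 * m" for x y
  proof -
    have "(norm (T (x - y)))\<^sup>2 = 2 * J x + 2 * J y - 4 * J ((1/2) *\<^sub>R (x + y))"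
      unfolding J_def
      by (simp add: power2_norm_eq_inner T.diff T.add T.scaleR f.add f.scaleR algebra_simps inner_commute)
    then show ?thesis using m_le[of "(1/2) *\<^sub>R (x + y)"] by linarith
  qed
  have "Cauchy X"
  proof (rule metric_CauchyI)
    fix e :: real assume e: "e > 0"
    obtain M where M: "4 / (c * e)\<^sup>2 < real M" using reals_Archimedean2 by blast
    have "dist (X i) (X j) < e" if ij: "i \<ge> M" "j \<ge> M" for i j
    proof -
      have M1: "4 / real (Suc M) < (c * e)\<^sup>2"
      proof -
        have "4 < real M * (c * e)\<^sup>2" using M c e by (simp add: field_simps)
        also have "\<dots> \<le> real (Suc M) * (c * e)\<^sup>2" by (intro mult_right_mono) auto
        finally show ?thesis by (simp add: field_simps)
      qed
      have le: "1 / real (Suc k) \<le> 1 / real (Suc M)" if "k \<ge> M" for k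
        using that by (simp add: field_simps)
      have "(norm (T (X i - X j)))\<^sup>2 \<le> 2 * J (X i) + 2 * J (X j) - 4 * m" by (rule par)
      also have "\<dots> < 4 / real (Suc M)" using X[of i] X[of j] le[OF ij(1)] le[OF ij(2)] by simp
      also have "\<dots> < (c * e)\<^sup>2" by (rule M1)
      finally have "norm (T (X i - X j)) < c * e"
        by (rule power_less_imp_less_base) (use c e in simp)
      then have "c * norm (X i - X j) < c * e" using c(2)[of "X i - X j"] by linarith
      then show ?thesis using c by (simp add: dist_norm)
    qed
    then show "\<exists>M. \<forall>i\<ge>M. \<forall>j\<ge>M. dist (X i) (X j) < e" by blast
  qed
  then obtain u where u: "X \<longlonglongrightarrow> u" using Cauchy_convergent_iff convergent_def by blast
  have "(\<lambda>n. J (X n)) \<longlonglongrightarrow> J u" unfolding J_def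
    by (intro tendsto_intros T.tendsto f.tendsto u)
  moreover have "(\<lambda>n. m + 1 / real (Suc n)) \<longlonglongrightarrow> m + 0"
    by (intro tendsto_intros LIMSEQ_Suc[OF lim_1_over_n])
  ultimately have Ju: "J u \<le> m"
    using X by (intro LIMSEQ_le[of "\<lambda>n. J (X n)" _ "\<lambda>n. m + 1 / real (Suc n)"]) (auto intro: less_imp_le)
  have "f x = inner (T x) (T u)" for x
  proof (rule ccontr)
    define a where "a = (norm (T x))\<^sup>2"
    define b where "b = inner (T x) (T u) - f x"
    assume "f x \<noteq> inner (T x) (T u)"
    then have b: "b \<noteq> 0" by (simp add: b_def)
    have a: "a \<ge> 0" by (simp add: a_def)
    have q: "0 \<le> s * (s * a + 2 * b)" for s
    proof -
      have "J (u + s *\<^sub>R x) - J u = s * (s * a + 2 * b)"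
        unfolding J_def a_def b_def
        by (simp add: power2_norm_eq_inner T.add T.scaleR f.add f.scaleR algebra_simps inner_commute)
      then show ?thesis using Ju m_le[of "u + s *\<^sub>R x"] by linarith
    qed
    have "0 \<le> (- b / (a + 1)) * ((- b / (a + 1)) * a + 2 * b)" by (rule q)
    also have "\<dots> = - (b\<^sup>2 * (a + 2) / (a + 1)\<^sup>2)"
      using a by (simp add: divide_simps) (simp add: power2_eq_square algebra_simps)
    finally show False using a b by (simp add: divide_le_0_iff mult_le_0_iff)
  qed
  then show thesis by (rule that)
qed

lemma cinner_scaleC_right: "cinner x (scaleC c y) = cnj c * cinner x (y::'h::chilbert_space)"
  by (metis cinner_commute cinner_scaleC_left complex_cnj_mult)

lemma cinner_eq_inner:
  "cinner x y = Complex (inner x y) (inner x (scaleC \<i> (y::'h::chilbert_space)))"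
  by (simp add: complex_eq_iff inner_eq_Re_cinner cinner_scaleC_right)

lemma inner_scaleC:
  "inner (scaleC c x) y = inner x (scaleC (cnj c) (y::'h::chilbert_space))"
  by (simp add: inner_eq_Re_cinner cinner_scaleC_right cinner_scaleC_left)

lemma scaleC_1 [simp]: "scaleC 1 x = (x::'h::chilbert_space)"
  using scaleC_of_real[of 1 x] by simp

lemma scaleC_0 [simp]: "scaleC 0 x = (0::'h::chilbert_space)"
  using scaleC_of_real[of 0 x] by simp

lemma scaleC_zero_right [simp]: "scaleC c 0 = (0::'h::chilbert_space)"
  using norm_scaleC[of c "0::'h"] by simp

lemma scaleC_minus_left: "scaleC (- c) x = - scaleC c (x::'h::chilbert_space)"
  using scaleC_add_left[of c "- c" x] by (simp add: eq_neg_iff_add_eq_0 add.commute)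

lemma scaleC_minus_right: "scaleC c (- x) = - scaleC c (x::'h::chilbert_space)"
  using scaleC_add_right[of c x "- x"] by (simp add: eq_neg_iff_add_eq_0 add.commute)

lemma scaleC_diff_right: "scaleC c (x - y) = scaleC c x - scaleC c (y::'h::chilbert_space)"
  using scaleC_add_right[of c x "- y"] by (simp add: scaleC_minus_right)

lemma scaleC_diff_left: "scaleC (c - d) x = scaleC c x - scaleC d (x::'h::chilbert_space)"
  using scaleC_add_left[of c "- d" x] by (simp add: scaleC_minus_left)

lemma cscale_apply [simp]: "blinfun_apply (cscale c A) x = scaleC c (blinfun_apply A x)"
  by (simp add: cscale.rep_eq)

lemma cscale_of_real: "cscale (complex_of_real r) A = r *\<^sub>R A"
  by (rule blinfun_eqI) (simp add: scaleC_of_real scaleR_blinfun.rep_eq)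

lemma clinear_opsD: "A \<in> clinear_ops \<Longrightarrow> blinfun_apply A (scaleC c x) = scaleC c (blinfun_apply A x)"
  by (simp add: clinear_ops_def)

lemma adjoint_exists:
  fixes A :: "'h::chilbert_space \<Rightarrow>\<^sub>L 'h"
  shows "\<exists>B::'h \<Rightarrow>\<^sub>L 'h. \<forall>x y. inner (blinfun_apply A x) y = inner x (blinfun_apply B y)"
proof -
  have "\<exists>u. \<forall>x. inner (A x) y = inner x u" for y
  proof -
    have f: "bounded_linear (\<lambda>x. inner (A x) y)"
      by (rule bounded_linear_compose[OF bounded_linear_inner_left blinfun.bounded_linear_right])
    show ?thesis
      using Lax_Milgram_square[OF bounded_linear_ident f, of 1] by auto
  qed
  then obtain B where B: "\<And>x y. inner (A x) y = inner x (B y)" by metis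
  have "bounded_linear B"
  proof (rule bounded_linear_intro)
    show "B (x + y) = B x + B y" for x y
      by (rule vector_eq_rdot[THEN iffD1]) (simp add: inner_add_right inner_commute flip: B)
    show "B (r *\<^sub>R x) = r *\<^sub>R B x" for r x
      by (rule vector_eq_rdot[THEN iffD1]) (metis B inner_commute inner_scaleR_right)
    show "norm (B y) \<le> norm y * norm A" for y
    proof -
      have "(norm (B y))\<^sup>2 = inner (A (B y)) y" by (simp add: B power2_norm_eq_inner)
      also have "\<dots> \<le> norm (A (B y)) * norm y" by (rule norm_cauchy_schwarz)
      also have "\<dots> \<le> (norm A * norm (B y)) * norm y"
        by (intro mult_right_mono norm_blinfun) auto
      finally show ?thesis
        by (cases "B y = 0") (auto simp: power2_eq_square mult_ac)
    qed
  qed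
  then show ?thesis
    by (intro exI[of _ "Blinfun B"]) (simp add: B bounded_linear_Blinfun_apply)
qed

lemma adj_unique:
  fixes A B :: "'h::chilbert_space \<Rightarrow>\<^sub>L 'h"
  assumes "A \<in> clinear_ops"
    and B: "\<And>x y. inner (blinfun_apply A x) y = inner x (blinfun_apply B y)"
  shows "adj A = B"
  unfolding adj_def
proof (rule the_equality)
  have "B (scaleC \<i> y) = scaleC \<i> (B y)" for y
  proof (rule vector_eq_rdot[THEN iffD1], intro allI)
    fix x :: 'h
    have "inner x (B (scaleC \<i> y)) = inner (A x) (scaleC \<i> y)" by (simp add: B)
    also have "\<dots> = inner (A (scaleC (- \<i>) x)) y"
      by (simp add: clinear_opsD[OF assms(1)] inner_scaleC)
    also have "\<dots> = inner x (scaleC \<i> (B y))" by (simp add: B inner_scaleC)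
    finally show "inner (B (scaleC \<i> y)) x = inner (scaleC \<i> (B y)) x" by (simp add: inner_commute)
  qed
  then show "\<forall>x y. cinner (A x) y = cinner x (B y)"
    by (simp add: cinner_eq_inner B)
next
  fix C assume C: "\<forall>x y. cinner (blinfun_apply A x) y = cinner x (blinfun_apply C y)"
  show "C = B"
  proof (rule blinfun_eqI, rule vector_eq_rdot[THEN iffD1], intro allI)
    fix y x show "inner (C y) x = inner (B y) x"
      using C B[of x y] by (metis inner_eq_Re_cinner inner_commute)
  qed
qed

lemma inner_adj:
  fixes A :: "'h::chilbert_space \<Rightarrow>\<^sub>L 'h"
  assumes "A \<in> clinear_ops"
  shows "inner (blinfun_apply A x) y = inner x (blinfun_apply (adj A) y)"
  using adjoint_exists[of A] adj_unique[OF assms] by metis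

section \<open>Self-adjoint operators\<close>

lemma clinear_ops_id [simp]: "id_blinfun \<in> clinear_ops"
  by (simp add: clinear_ops_def)

lemma clinear_ops_0 [simp]: "0 \<in> clinear_ops"
  by (simp add: clinear_ops_def)

lemma clinear_ops_add: "A \<in> clinear_ops \<Longrightarrow> B \<in> clinear_ops \<Longrightarrow> A + B \<in> clinear_ops"
  by (simp add: clinear_ops_def blinfun.add_left scaleC_add_right)

lemma clinear_ops_diff: "A \<in> clinear_ops \<Longrightarrow> B \<in> clinear_ops \<Longrightarrow> A - B \<in> clinear_ops"
  by (simp add: clinear_ops_def blinfun.diff_left scaleC_diff_right)

lemma clinear_ops_cscale: "A \<in> clinear_ops \<Longrightarrow> cscale c A \<in> clinear_ops"
  by (simp add: clinear_ops_def scaleC_scaleC mult.commute)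

lemma clinear_ops_scaleR: "A \<in> clinear_ops \<Longrightarrow> r *\<^sub>R A \<in> clinear_ops"
  using clinear_ops_cscale[of A "of_real r"] by (simp add: cscale_of_real)

lemma clinear_ops_compose: "A \<in> clinear_ops \<Longrightarrow> B \<in> clinear_ops \<Longrightarrow> A o\<^sub>L B \<in> clinear_ops"
  by (simp add: clinear_ops_def)

lemmas compose_bilinear = bounded_bilinear.add_left[OF bounded_bilinear_blinfun_compose]
  bounded_bilinear.add_right[OF bounded_bilinear_blinfun_compose]
  bounded_bilinear.diff_left[OF bounded_bilinear_blinfun_compose]
  bounded_bilinear.diff_right[OF bounded_bilinear_blinfun_compose]
  bounded_bilinear.scaleR_left[OF bounded_bilinear_blinfun_compose]
  bounded_bilinear.scaleR_right[OF bounded_bilinear_blinfun_compose]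
  bounded_bilinear.minus_left[OF bounded_bilinear_blinfun_compose]
  bounded_bilinear.minus_right[OF bounded_bilinear_blinfun_compose]

lemma compose_assoc: "(A o\<^sub>L B) o\<^sub>L C = A o\<^sub>L (B o\<^sub>L C)"
  by (rule blinfun_eqI) simp

lemma compose_id [simp]: "A o\<^sub>L id_blinfun = A" "id_blinfun o\<^sub>L A = A"
  by (auto intro: blinfun_eqI)

lemma cscale_compose_left: "cscale c A o\<^sub>L B = cscale c (A o\<^sub>L B)"
  by (rule blinfun_eqI) simp

lemma cscale_compose_right: "A \<in> clinear_ops \<Longrightarrow> A o\<^sub>L cscale c B = cscale c (A o\<^sub>L B)"
  by (rule blinfun_eqI) (simp add: clinear_opsD)

lemma cscale_cscale: "cscale c (cscale d A) = cscale (c * d) A"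
  by (rule blinfun_eqI) (simp add: scaleC_scaleC)

lemma cscale_0 [simp]: "cscale 0 A = 0"
  by (auto intro: blinfun_eqI)

lemma cscale_1 [simp]: "cscale 1 A = A"
  by (auto intro: blinfun_eqI)

lemma cscale_add_left: "cscale (c + d) A = cscale c A + cscale d A"
  by (rule blinfun_eqI) (simp add: blinfun.add_left scaleC_add_left)

lemma cscale_minus_left: "cscale (- c) A = - cscale c A"
  by (rule blinfun_eqI) (simp add: blinfun.minus_left scaleC_minus_left)

lemma cscale_diff_left: "cscale (c - d) A = cscale c A - cscale d A"
  by (rule blinfun_eqI) (simp add: blinfun.diff_left scaleC_diff_left)

lemma cscale_diff: "cscale c (A - B) = cscale c A - cscale c B"
  by (rule blinfun_eqI) (simp add: blinfun.diff_left scaleC_diff_right)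

definition selfadj :: "('h::chilbert_space \<Rightarrow>\<^sub>L 'h) \<Rightarrow> bool" where
  "selfadj A \<longleftrightarrow> A \<in> clinear_ops \<and>
     (\<forall>x y. inner (blinfun_apply A x) y = inner x (blinfun_apply A y))"

lemma selfadj_iff: "selfadj A \<longleftrightarrow> A \<in> clinear_ops \<and> adj A = A"
  unfolding selfadj_def using adj_unique[of A A] inner_adj[of A] by auto

lemma selfadj_id [simp]: "selfadj id_blinfun"
  by (simp add: selfadj_def)

lemma selfadj_0 [simp]: "selfadj 0"
  by (simp add: selfadj_def)

lemma selfadj_add: "selfadj A \<Longrightarrow> selfadj B \<Longrightarrow> selfadj (A + B)"
  by (simp add: selfadj_def clinear_ops_add blinfun.add_left inner_add_left inner_add_right)

lemma selfadj_diff: "selfadj A \<Longrightarrow> selfadj B \<Longrightarrow> selfadj (A - B)"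
  by (simp add: selfadj_def clinear_ops_diff blinfun.diff_left inner_diff_left inner_diff_right)

lemma selfadj_scaleR: "selfadj A \<Longrightarrow> selfadj (r *\<^sub>R A)"
  by (simp add: selfadj_def clinear_ops_scaleR scaleR_blinfun.rep_eq)

lemma selfadj_compose: "selfadj A \<Longrightarrow> selfadj B \<Longrightarrow> A o\<^sub>L B = B o\<^sub>L A \<Longrightarrow> selfadj (A o\<^sub>L B)"
  unfolding selfadj_def by (metis blinfun_apply_blinfun_compose clinear_ops_compose)

lemma closed_clinear_ops: "closed (clinear_ops :: ('h::chilbert_space \<Rightarrow>\<^sub>L 'h) set)"
  unfolding closed_sequential_limits
proof safe
  fix A :: "nat \<Rightarrow> 'h \<Rightarrow>\<^sub>L 'h" and B
  assume A: "\<forall>n. A n \<in> clinear_ops" and lim: "A \<longlonglongrightarrow> B"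
  have "B (scaleC c x) = scaleC c (B x)" for c x
  proof (rule LIMSEQ_unique)
    show "(\<lambda>n. A n (scaleC c x)) \<longlonglongrightarrow> B (scaleC c x)"
      by (intro tendsto_intros lim)
    have "(\<lambda>n. cscale c id_blinfun (A n x)) \<longlonglongrightarrow> cscale c id_blinfun (B x)"
      by (intro tendsto_intros lim)
    then show "(\<lambda>n. A n (scaleC c x)) \<longlonglongrightarrow> scaleC c (B x)"
      using A by (simp add: clinear_opsD)
  qed
  then show "B \<in> clinear_ops" by (simp add: clinear_ops_def)
qed

lemma selfadj_limit:
  fixes A :: "nat \<Rightarrow> 'h::chilbert_space \<Rightarrow>\<^sub>L 'h"
  assumes A: "\<And>n. selfadj (A n)" and lim: "A \<longlonglongrightarrow> B"
  shows "selfadj B"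
  unfolding selfadj_def
proof (intro conjI allI)
  show "B \<in> clinear_ops"
    using closed_clinear_ops A lim unfolding closed_sequential_limits selfadj_def by blast
  show "inner (B x) y = inner x (B y)" for x y
  proof (rule LIMSEQ_unique)
    show "(\<lambda>n. inner (A n x) y) \<longlonglongrightarrow> inner (B x) y"
      by (intro tendsto_intros lim)
    have "(\<lambda>n. inner x (A n y)) \<longlonglongrightarrow> inner x (B y)"
      by (intro tendsto_intros lim)
    then show "(\<lambda>n. inner (A n x) y) \<longlonglongrightarrow> inner x (B y)"
      using A by (simp add: selfadj_def)
  qed
qed

definition bounded_below :: "('a::real_normed_vector \<Rightarrow>\<^sub>L 'b::real_normed_vector) \<Rightarrow> bool" where
  "bounded_below T \<longleftrightarrow> (\<exists>c>0. \<forall>x. norm (blinfun_apply T x) \<ge> c * norm x)"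

lemma bounded_belowI: "c > 0 \<Longrightarrow> (\<And>x. norm (blinfun_apply T x) \<ge> c * norm x) \<Longrightarrow> bounded_below T"
  by (auto simp: bounded_below_def)

lemma bounded_below_compose:
  assumes "bounded_below S" "bounded_below T"
  shows "bounded_below (S o\<^sub>L T)"
proof -
  obtain c d where c: "c > 0" "\<And>x. norm (S x) \<ge> c * norm x" and d: "d > 0" "\<And>x. norm (T x) \<ge> d * norm x"
    using assms unfolding bounded_below_def by blast
  show ?thesis
  proof (rule bounded_belowI)
    show "norm ((S o\<^sub>L T) x) \<ge> (c * d) * norm x" for x
      using order_trans[OF mult_left_mono[OF d(2)[of x], of c] c(2)[of "T x"]] c(1)
      by (simp add: mult.assoc)
  qed (use c d in simp)
qed

lemma selfadj_bounded_below_inverse: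
  fixes T :: "'h::chilbert_space \<Rightarrow>\<^sub>L 'h"
  assumes T: "selfadj T" and bb: "bounded_below T"
  obtains B where "B \<in> clinear_ops" "B o\<^sub>L T = id_blinfun" "T o\<^sub>L B = id_blinfun"
proof -
  obtain c where c: "c > 0" "\<And>x. norm (T x) \<ge> c * norm x"
    using bb unfolding bounded_below_def by blast
  have lin: "T (scaleC a x) = scaleC a (T x)" for a x
    using T by (simp add: selfadj_def clinear_opsD)
  have inj: "x = y" if "T x = T y" for x y
    using c(2)[of "x - y"] c(1) that by (simp add: blinfun.diff_right mult_le_0_iff)
  have "\<exists>u. T u = y" for y
  proof -
    obtain u where "\<And>x. inner x y = inner (T x) (T u)"
      using Lax_Milgram_square[OF blinfun.bounded_linear_right bounded_linear_inner_left c, of y]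
      by metis
    then have "inner x y = inner x (T (T u))" for x using T by (simp add: selfadj_def)
    then have "y = T (T u)" using vector_eq_ldot by blast
    then show ?thesis by metis
  qed
  then obtain B where B: "\<And>y. T (B y) = y" by metis
  have "bounded_linear B"
  proof (rule bounded_linear_intro)
    show "B (x + y) = B x + B y" for x y by (rule inj) (simp add: B blinfun.add_right)
    show "B (r *\<^sub>R x) = r *\<^sub>R B x" for r x by (rule inj) (simp add: B blinfun.scaleR_right)
    show "norm (B y) \<le> norm y * (1 / c)" for y
      using c(2)[of "B y"] c(1) by (simp add: B field_simps)
  qed
  then have app: "blinfun_apply (Blinfun B) = B" by (rule bounded_linear_Blinfun_apply)
  show thesis
  proof (rule that)
    show "Blinfun B \<in> clinear_ops"
      unfolding clinear_ops_def mem_Collect_eq app by (intro allI, rule inj) (simp add: B lin)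
    show "Blinfun B o\<^sub>L T = id_blinfun"
      by (rule blinfun_eqI, rule inj) (simp add: app B)
    show "T o\<^sub>L Blinfun B = id_blinfun"
      by (rule blinfun_eqI) (simp add: app B)
  qed
qed

text \<open>The approximate point spectrum on the real axis; for self-adjoint operators it is the whole
  spectrum.\<close>

definition rspec :: "('h::chilbert_space \<Rightarrow>\<^sub>L 'h) \<Rightarrow> real set" where
  "rspec A = {t. \<not> bounded_below (A - t *\<^sub>R id_blinfun)}"

lemma real_spectrum_eq_rspec:
  fixes A :: "'h::chilbert_space \<Rightarrow>\<^sub>L 'h"
  assumes A: "selfadj A"
  shows "{t. complex_of_real t \<in> spectrum A} = rspec A"
proof -
  have "(\<exists>B \<in> clinear_ops. B o\<^sub>L T = id_blinfun \<and> T o\<^sub>L B = id_blinfun) \<longleftrightarrow> bounded_below T"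
    if T: "selfadj T" for T :: "'h \<Rightarrow>\<^sub>L 'h"
  proof
    assume "\<exists>B \<in> clinear_ops. B o\<^sub>L T = id_blinfun \<and> T o\<^sub>L B = id_blinfun"
    then obtain B where B: "B o\<^sub>L T = id_blinfun" by blast
    have "norm x \<le> (norm B + 1) * norm (T x)" for x
    proof -
      have "x = B (T x)" using arg_cong[OF B, of "\<lambda>S. blinfun_apply S x"] by simp
      then have "norm x \<le> norm B * norm (T x)" by (metis norm_blinfun)
      then show ?thesis by (simp add: distrib_right add_increasing2)
    qed
    then have "1 / (norm B + 1) * norm x \<le> norm (T x)" for x
      using norm_ge_zero[of B] by (simp add: pos_divide_le_eq mult.commute add_nonneg_pos)
    then show "bounded_below T"
      by (rule bounded_belowI[rotated]) (simp add: add_nonneg_pos)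
  next
    assume "bounded_below T"
    then show "\<exists>B \<in> clinear_ops. B o\<^sub>L T = id_blinfun \<and> T o\<^sub>L B = id_blinfun"
      using selfadj_bounded_below_inverse[OF T] by metis
  qed
  from this[OF selfadj_diff[OF A selfadj_scaleR[OF selfadj_id]]]
  show ?thesis
    by (auto simp: spectrum_def rspec_def cscale_of_real)
qed

lemma abs_rspec_le_norm:
  fixes A :: "'h::chilbert_space \<Rightarrow>\<^sub>L 'h"
  assumes "t \<in> rspec A"
  shows "\<bar>t\<bar> \<le> norm A"
proof (rule ccontr)
  assume t: "\<not> \<bar>t\<bar> \<le> norm A"
  have "norm ((A - t *\<^sub>R id_blinfun) x) \<ge> (\<bar>t\<bar> - norm A) * norm x" for x
  proof -
    have "\<bar>t\<bar> * norm x \<le> norm (A x) + norm ((A - t *\<^sub>R id_blinfun) x)"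
      using norm_triangle_ineq4[of "A x" "(A - t *\<^sub>R id_blinfun) x"]
      by (simp add: blinfun.diff_left scaleR_blinfun.rep_eq)
    then show ?thesis using norm_blinfun[of A x] by (simp add: algebra_simps)
  qed
  then have "bounded_below (A - t *\<^sub>R id_blinfun)"
    by (rule bounded_belowI[rotated]) (use t in simp)
  then show False using assms by (simp add: rspec_def)
qed

lemma compact_rspec:
  fixes A :: "'h::chilbert_space \<Rightarrow>\<^sub>L 'h"
  shows "compact (rspec A)"
proof -
  have "bounded (rspec A)" using abs_rspec_le_norm by (auto simp: bounded_iff)
  moreover have "open (- rspec A)"
    unfolding open_dist
  proof
    fix t assume "t \<in> - rspec A"
    then obtain c where c: "c > 0" "\<And>x. norm ((A - t *\<^sub>R id_blinfun) x) \<ge> c * norm x"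
      by (auto simp: rspec_def bounded_below_def)
    have "s \<in> - rspec A" if s: "dist s t < c" for s
    proof -
      have "norm ((A - s *\<^sub>R id_blinfun) x) \<ge> (c - \<bar>s - t\<bar>) * norm x" for x
      proof -
        have "(A - t *\<^sub>R id_blinfun) x = (A - s *\<^sub>R id_blinfun) x + (s - t) *\<^sub>R x"
          by (simp add: blinfun.diff_left scaleR_blinfun.rep_eq algebra_simps)
        then have "norm ((A - t *\<^sub>R id_blinfun) x) \<le> norm ((A - s *\<^sub>R id_blinfun) x) + \<bar>s - t\<bar> * norm x"
          by (metis norm_scaleR norm_triangle_ineq)
        then show ?thesis using c(2)[of x] by (simp add: algebra_simps)
      qed
      then have "bounded_below (A - s *\<^sub>R id_blinfun)"
        by (rule bounded_belowI[rotated]) (use s in \<open>simp add: dist_real_def\<close>)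
      then show ?thesis by (simp add: rspec_def)
    qed
    then show "\<exists>e>0. \<forall>y. dist y t < e \<longrightarrow> y \<in> - rspec A" using c(1) by blast
  qed
  ultimately show ?thesis by (simp add: compact_eq_bounded_closed closed_open)
qed

lemma op_pow_0 [simp]: "op_pow A 0 = id_blinfun"
  by (simp add: op_pow_def)

lemma op_pow_Suc [simp]: "op_pow A (Suc n) = A o\<^sub>L op_pow A n"
  by (simp add: op_pow_def)

lemma op_poly_eq_sum: "degree q \<le> n \<Longrightarrow> op_poly q A = (\<Sum>i\<le>n. coeff q i *\<^sub>R op_pow A i)"
  unfolding op_poly_def
  by (rule sum.mono_neutral_left) (auto simp: coeff_eq_0)

lemma op_poly_0 [simp]: "op_poly 0 A = 0"
  by (simp add: op_poly_def)

lemma op_poly_add: "op_poly (p + q) A = op_poly p A + op_poly q A"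
proof -
  define n where "n = max (degree p) (degree q)"
  have "degree (p + q) \<le> n" unfolding n_def by (rule degree_add_le_max)
  then show ?thesis
    using op_poly_eq_sum[of p n A] op_poly_eq_sum[of q n A] op_poly_eq_sum[of "p + q" n A]
    by (simp add: n_def scaleR_add_left sum.distrib)
qed

lemma op_poly_smult: "op_poly (smult c p) A = c *\<^sub>R op_poly p A"
  using op_poly_eq_sum[OF degree_smult_le, of c p A] op_poly_eq_sum[of p "degree p" A]
  by (simp add: scaleR_sum_right)

lemma op_poly_pCons: "op_poly (pCons a p) A = a *\<^sub>R id_blinfun + (A o\<^sub>L op_poly p A)"
proof -
  have "op_poly (pCons a p) A = (\<Sum>i\<le>Suc (degree p). coeff (pCons a p) i *\<^sub>R op_pow A i)"
    by (rule op_poly_eq_sum) (rule degree_pCons_le)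
  then show ?thesis
    by (simp add: sum.atMost_Suc_shift op_poly_def compose_bilinear
        bounded_bilinear.sum_right[OF bounded_bilinear_blinfun_compose] del: sum.atMost_Suc)
qed

lemma op_poly_diff: "op_poly (p - q) A = op_poly p A - op_poly q A"
  using op_poly_add[of p "smult (-1) q" A] unfolding op_poly_smult by simp

lemma op_poly_mult: "op_poly (p * q) A = op_poly p A o\<^sub>L op_poly q A"
proof (induction p rule: pCons_induct)
  case (pCons a p)
  then show ?case
    by (simp add: op_poly_add op_poly_smult op_poly_pCons compose_bilinear compose_assoc)
qed simp

lemma op_poly_commute: "op_poly p A o\<^sub>L op_poly q A = op_poly q A o\<^sub>L op_poly p A"
  by (metis mult.commute op_poly_mult)

lemma op_poly_X: "op_poly [:0, 1:] A = A"
  by (simp add: op_poly_pCons)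

lemma selfadj_op_poly: "selfadj A \<Longrightarrow> selfadj (op_poly q A)"
proof (induction q rule: pCons_induct)
  case (pCons a p)
  then show ?case
    using op_poly_commute[of "[:0, 1:]" A p] unfolding op_poly_X
    by (auto simp: op_poly_pCons intro!: selfadj_add selfadj_scaleR selfadj_compose)
qed simp

section \<open>Continuous functional calculus\<close>

instance chilbert_space \<subseteq> banach ..

definition cop_poly :: "complex poly \<Rightarrow> ('h::chilbert_space \<Rightarrow>\<^sub>L 'h) \<Rightarrow> ('h \<Rightarrow>\<^sub>L 'h)" where
  "cop_poly q A = (\<Sum>i\<le>degree q. cscale (coeff q i) (op_pow A i))"

lemma cop_poly_of_real:
  "cop_poly (map_poly complex_of_real q) A = op_poly q A"
  by (simp add: cop_poly_def op_poly_def degree_map_poly coeff_map_poly cscale_of_real)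

lemma cop_poly_linear_mult:
  assumes A: "A \<in> clinear_ops"
  shows "cop_poly ([:- z, 1:] * s) A = (A - cscale z id_blinfun) o\<^sub>L cop_poly s A"
proof (cases "s = 0")
  case False
  define n where "n = degree s"
  have deg: "degree ([:- z, 1:] * s) = Suc n"
    using False by (subst degree_mult_eq) (auto simp: n_def)
  have coeff: "coeff ([:- z, 1:] * s) i = coeff (pCons 0 s) i - z * coeff s i" for i
    by (simp add: mult_pCons_left)
  have split: "cop_poly ([:- z, 1:] * s) A =
      (\<Sum>i\<le>Suc n. cscale (coeff (pCons 0 s) i) (op_pow A i)) - (\<Sum>i\<le>Suc n. cscale (z * coeff s i) (op_pow A i))"
    unfolding cop_poly_def deg coeff cscale_diff_left sum_subtractf ..
  have "(\<Sum>i\<le>Suc n. cscale (coeff (pCons 0 s) i) (op_pow A i)) = A o\<^sub>L cop_poly s A"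
    by (simp add: cop_poly_def n_def sum.atMost_Suc_shift cscale_compose_right[OF A]
        bounded_bilinear.sum_right[OF bounded_bilinear_blinfun_compose] del: sum.atMost_Suc)
  moreover have "(\<Sum>i\<le>Suc n. cscale (z * coeff s i) (op_pow A i)) = cscale z id_blinfun o\<^sub>L cop_poly s A"
    by (simp add: cop_poly_def n_def coeff_eq_0 cscale_compose_left cscale_cscale
        bounded_bilinear.sum_right[OF bounded_bilinear_blinfun_compose])
  ultimately show ?thesis unfolding split compose_bilinear by simp
qed (simp add: cop_poly_def)

lemma bounded_below_cop_poly:
  assumes A: "A \<in> clinear_ops"
  shows "r \<noteq> 0 \<Longrightarrow> (\<And>z. poly r z = 0 \<Longrightarrow> bounded_below (A - cscale z id_blinfun)) \<Longrightarrow>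
    bounded_below (cop_poly r A)"
proof (induction "degree r" arbitrary: r)
  case 0
  then obtain c where c: "r = [:c:]" by (metis degree_0_id)
  show ?case
    by (rule bounded_belowI[of "cmod c"]) (use c 0 in \<open>auto simp: cop_poly_def norm_scaleC\<close>)
next
  case (Suc n)
  then have "\<not> constant (poly r)" by (simp add: constant_degree)
  then obtain z where z: "poly r z = 0" using fundamental_theorem_of_algebra by blast
  then obtain s where s: "r = [:- z, 1:] * s" by (metis dvdE poly_eq_0_iff_dvd)
  have "s \<noteq> 0" using s Suc by auto
  then have "degree r = Suc (degree s)" unfolding s by (subst degree_mult_eq) auto
  then have "bounded_below (cop_poly s A)"
    using Suc.hyps \<open>s \<noteq> 0\<close> Suc.prems by (intro Suc.hyps(1)) (auto simp: s)
  then show ?case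
    unfolding s cop_poly_linear_mult[OF A]
    using Suc.prems(2)[OF z] by (rule bounded_below_compose[rotated])
qed

lemma selfadj_bounded_below_nonreal:
  assumes A: "selfadj A" and z: "Im z \<noteq> 0"
  shows "bounded_below (A - cscale z id_blinfun)"
proof (rule bounded_belowI[of "\<bar>Im z\<bar>"])
  fix x
  define B where "B = A - Re z *\<^sub>R id_blinfun"
  have B: "selfadj B" unfolding B_def using A by (intro selfadj_diff selfadj_scaleR) auto
  have eq: "(A - cscale z id_blinfun) x = B x - scaleC (\<i> * Im z) x"
  proof -
    have "scaleC z x = Re z *\<^sub>R x + scaleC (\<i> * Im z) x"
      using scaleC_add_left[of "of_real (Re z)" "\<i> * Im z" x] complex_eq[of z]
      by (simp add: scaleC_of_real)
    then show ?thesis by (simp add: B_def blinfun.diff_left scaleR_blinfun.rep_eq)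
  qed
  have "inner (B x) (scaleC (\<i> * Im z) x) = 0"
  proof -
    let ?c = "\<i> * complex_of_real (Im z)"
    have "inner (B x) (scaleC ?c x) = inner x (scaleC ?c (B x))"
      using B by (simp add: selfadj_def clinear_opsD)
    also have "\<dots> = inner (scaleC (cnj ?c) x) (B x)" by (simp add: inner_scaleC)
    also have "\<dots> = - inner (B x) (scaleC ?c x)"
      by (simp add: scaleC_minus_left inner_commute)
    finally show ?thesis by simp
  qed
  then have "(norm ((A - cscale z id_blinfun) x))\<^sup>2 = (norm (B x))\<^sup>2 + (norm (scaleC (\<i> * Im z) x))\<^sup>2"
    unfolding eq by (simp add: power2_norm_eq_inner inner_diff_left inner_diff_right inner_commute)
  then have "(\<bar>Im z\<bar> * norm x)\<^sup>2 \<le> (norm ((A - cscale z id_blinfun) x))\<^sup>2"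
    by (simp add: norm_scaleC norm_mult)
  then show "\<bar>Im z\<bar> * norm x \<le> norm ((A - cscale z id_blinfun) x)"
    by (rule power2_le_imp_le) simp
qed (use z in simp)

lemma rspec_polynomial_root:
  assumes A: "selfadj A" and r: "r \<noteq> 0" and nbb: "\<not> bounded_below (op_poly r A)"
  obtains t where "t \<in> rspec A" "poly r t = 0"
proof -
  let ?r = "map_poly complex_of_real r"
  have "?r \<noteq> 0" using r by (simp add: map_poly_eq_0_iff)
  moreover have "\<not> bounded_below (cop_poly ?r A)" using nbb by (simp add: cop_poly_of_real)
  moreover have "A \<in> clinear_ops" using A by (simp add: selfadj_def)
  ultimately obtain z where z: "poly ?r z = 0" "\<not> bounded_below (A - cscale z id_blinfun)"
    using bounded_below_cop_poly by blast
  then have "Im z = 0" using selfadj_bounded_below_nonreal[OF A] by blast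
  then have zr: "z = of_real (Re z)" by (simp add: complex_eq_iff)
  have "poly ?r (complex_of_real t) = of_real (poly r t)" for t
    by (induction r) (auto simp: map_poly_pCons)
  then have "poly r (Re z) = 0" using z(1) zr by (metis of_real_eq_0_iff)
  moreover have "Re z \<in> rspec A" using z(2) zr by (metis cscale_of_real mem_Collect_eq rspec_def)
  ultimately show thesis using that by blast
qed

text \<open>A self-adjoint \<open>T\<close> nearly attains its norm at unit vectors, and these are approximate
  eigenvectors of \<open>T\<^sup>2\<close>.\<close>

lemma not_bounded_below_norm_square:
  fixes T :: "'h::chilbert_space \<Rightarrow>\<^sub>L 'h"
  assumes T: "selfadj T" and nz: "(x0::'h) \<noteq> 0"
  shows "\<not> bounded_below ((T o\<^sub>L T) - (norm T)\<^sup>2 *\<^sub>R id_blinfun)"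
proof
  define M where "M = norm T"
  assume "bounded_below ((T o\<^sub>L T) - (norm T)\<^sup>2 *\<^sub>R id_blinfun)"
  then obtain c where c: "c > 0" "\<And>x. norm (((T o\<^sub>L T) - M\<^sup>2 *\<^sub>R id_blinfun) x) \<ge> c * norm x"
    unfolding bounded_below_def M_def by blast
  have le: "c\<^sup>2 * (norm x)\<^sup>2 \<le> M\<^sup>2 * (M\<^sup>2 * (norm x)\<^sup>2 - (norm (T x))\<^sup>2)" for x
  proof -
    have "(c * norm x)\<^sup>2 \<le> (norm (((T o\<^sub>L T) - M\<^sup>2 *\<^sub>R id_blinfun) x))\<^sup>2"
      by (intro power_mono c(2)) (use c(1) in simp)
    moreover have "(norm (((T o\<^sub>L T) - M\<^sup>2 *\<^sub>R id_blinfun) x))\<^sup>2 =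
      (norm (T (T x)))\<^sup>2 - 2 * M\<^sup>2 * (norm (T x))\<^sup>2 + M\<^sup>2 * M\<^sup>2 * (norm x)\<^sup>2"
    proof -
      have expand: "(norm (u - m *\<^sub>R v))\<^sup>2 = (norm u)\<^sup>2 - 2 * m * inner u v + m * m * (norm v)\<^sup>2"
        for u v :: 'h and m
        by (simp add: power2_norm_eq_inner inner_diff_left inner_diff_right inner_commute algebra_simps)
      have "inner (T (T x)) x = (norm (T x))\<^sup>2"
        using T by (simp add: selfadj_def power2_norm_eq_inner)
      then show ?thesis
        using expand[of "T (T x)" "M\<^sup>2" x] by (simp add: blinfun.diff_left scaleR_blinfun.rep_eq)
    qed
    moreover have "norm (T (T x)) \<le> M * norm (T x)"
      unfolding M_def by (rule norm_blinfun)
    then have "(norm (T (T x)))\<^sup>2 \<le> (M * norm (T x))\<^sup>2"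
      by (rule power_mono) (rule norm_ge_zero)
    ultimately show ?thesis unfolding power_mult_distrib by (simp add: algebra_simps)
  qed
  have M: "M > 0"
  proof (rule ccontr)
    assume "\<not> M > 0"
    then have "M = 0" by (simp add: M_def)
    then show False using le[of x0] c(1) nz by (simp add: mult_le_0_iff)
  qed
  define b where "b = M\<^sup>2 - c\<^sup>2 / M\<^sup>2"
  have le': "(norm (T x))\<^sup>2 \<le> b * (norm x)\<^sup>2" for x
    using le[of x] M by (simp add: b_def field_simps)
  have b0: "b \<ge> 0"
  proof (rule ccontr)
    assume "\<not> b \<ge> 0"
    then have "b * (norm x0)\<^sup>2 < 0" using nz by (simp add: mult_neg_pos)
    then show False using le'[of x0] by (smt (verit) zero_le_power2)
  qed
  have "M \<le> sqrt b"
    unfolding M_def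
  proof (rule norm_blinfun_bound)
    show "norm (T x) \<le> sqrt b * norm x" for x
      using real_sqrt_le_mono[OF le'[of x]] by (simp add: real_sqrt_mult)
  qed (use b0 in simp)
  then have "M\<^sup>2 \<le> b" using power_mono[of M "sqrt b" 2] M b0 by simp
  then show False using c(1) M by (simp add: b_def divide_le_0_iff)
qed

lemma norm_op_poly_le:
  fixes A :: "'h::chilbert_space \<Rightarrow>\<^sub>L 'h"
  assumes A: "selfadj A" and e: "e \<ge> 0" and q: "\<And>t. t \<in> rspec A \<Longrightarrow> \<bar>poly q t\<bar> \<le> e"
  shows "norm (op_poly q A) \<le> e"
proof (rule ccontr)
  define M where "M = norm (op_poly q A)"
  assume "\<not> ?thesis"
  then have M: "M > e" by (simp add: M_def)
  have "\<exists>x::'h. x \<noteq> 0"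
  proof (rule ccontr)
    assume "\<not> ?thesis"
    then have "op_poly q A = 0" by (intro blinfun_eqI) metis
    then show False using M e by (simp add: M_def)
  qed
  then obtain x0 :: 'h where x0: "x0 \<noteq> 0" by blast
  have root: "\<exists>t\<in>rspec A. (poly s t)\<^sup>2 = (norm (op_poly s A))\<^sup>2"
    if "s * s \<noteq> [:(norm (op_poly s A))\<^sup>2:]" for s
  proof -
    define r where "r = s * s - [:(norm (op_poly s A))\<^sup>2:]"
    have "op_poly r A = (op_poly s A o\<^sub>L op_poly s A) - (norm (op_poly s A))\<^sup>2 *\<^sub>R id_blinfun"
      by (simp add: r_def op_poly_diff op_poly_mult op_poly_pCons)
    then have "\<not> bounded_below (op_poly r A)"
      using not_bounded_below_norm_square[OF selfadj_op_poly[OF A] x0] by simp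
    moreover have "r \<noteq> 0" using that by (simp add: r_def)
    ultimately obtain t where "t \<in> rspec A" "poly r t = 0" using rspec_polynomial_root[OF A] by blast
    then show ?thesis by (auto simp: r_def power2_eq_square)
  qed
  have "\<exists>t\<in>rspec A. (poly q t)\<^sup>2 = M\<^sup>2"
  proof (cases "q * q = [:M\<^sup>2:]")
    case True
    have "[:0, 1:] * [:0, 1:] \<noteq> [:(norm (op_poly [:0, 1:] A))\<^sup>2:]" by simp
    then obtain t where t: "t \<in> rspec A" using root by blast
    have "poly (q * q) t = M\<^sup>2" unfolding True by simp
    then show ?thesis using t by (auto simp: power2_eq_square)
  qed (use root[of q] M_def in auto)
  then obtain t where t: "t \<in> rspec A" "\<bar>poly q t\<bar> = \<bar>M\<bar>" by (metis power2_eq_iff abs_minus)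
  then show False using q[of t] M e by simp
qed

lemma rspec_annihilator:
  assumes "op_poly q A = 0" and t: "t \<in> rspec A"
  shows "poly q t = 0"
proof (rule ccontr)
  assume nz: "poly q t \<noteq> 0"
  define S where "S = op_poly (synthetic_div q t) A"
  let ?T = "A - t *\<^sub>R id_blinfun"
  have "q = synthetic_div q t * [:- t, 1:] + [:poly q t:]"
    using synthetic_div_correct'[of t q] by (simp only: mult.commute)
  then have "0 = op_poly (synthetic_div q t * [:- t, 1:] + [:poly q t:]) A" using assms(1) by simp
  also have "\<dots> = (S o\<^sub>L ?T) + poly q t *\<^sub>R id_blinfun"
    unfolding op_poly_add op_poly_mult S_def by (simp add: op_poly_pCons)
  finally have "poly q t *\<^sub>R id_blinfun = - (S o\<^sub>L ?T)" by (metis add_eq_0_iff2 minus_equation_iff)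
  then have "poly q t *\<^sub>R x = - S (?T x)" for x
    by (metis blinfun.minus_left blinfun.scaleR_left blinfun_apply_blinfun_compose id_blinfun.rep_eq)
  then have eq: "\<bar>poly q t\<bar> * norm x = norm (S (?T x))" for x
    by (metis norm_minus_cancel norm_scaleR)
  have "\<bar>poly q t\<bar> / (norm S + 1) * norm x \<le> norm (?T x)" for x
  proof -
    have "\<bar>poly q t\<bar> * norm x \<le> norm S * norm (?T x)" unfolding eq by (rule norm_blinfun)
    also have "\<dots> \<le> (norm S + 1) * norm (?T x)" by (intro mult_right_mono) auto
    finally show ?thesis
      using norm_ge_zero[of S] by (simp add: pos_divide_le_eq mult_ac add_nonneg_pos)
  qed
  then have "bounded_below ?T"
    by (rule bounded_belowI[rotated]) (use nz in \<open>simp add: add_nonneg_pos\<close>)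
  then show False using t by (simp add: rspec_def)
qed

lemma polynomial_uniform_approx:
  fixes f :: "real \<Rightarrow> real"
  assumes "compact S" "continuous_on S f"
  obtains q where "uniform_limit S (\<lambda>n t. poly (q n) t) f sequentially"
proof -
  have "\<exists>q. \<forall>t\<in>S. \<bar>f t - poly q t\<bar> < 1 / real (Suc n)" for n
  proof -
    obtain g where g: "real_polynomial_function g" "\<And>t. t \<in> S \<Longrightarrow> \<bar>f t - g t\<bar> < 1 / real (Suc n)"
      using Stone_Weierstrass_real_polynomial_function[OF assms, of "1 / real (Suc n)"] by auto
    obtain a m where "g = (\<lambda>x. \<Sum>i\<le>m. a i * x ^ i)"
      using g(1) real_polynomial_function_iff_sum by blast
    then have "g t = poly (\<Sum>i\<le>m. monom (a i) i) t" for t by (simp add: poly_sum poly_monom)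
    then show ?thesis using g(2) by metis
  qed
  then obtain q where q: "\<And>n t. t \<in> S \<Longrightarrow> \<bar>f t - poly (q n) t\<bar> < 1 / real (Suc n)" by metis
  have "uniform_limit S (\<lambda>n t. poly (q n) t) f sequentially"
    unfolding uniform_limit_iff
  proof safe
    fix e :: real assume "e > 0"
    then have "\<forall>\<^sub>F n in sequentially. 1 / real (Suc n) < e"
      using order_tendstoD(2)[OF LIMSEQ_Suc[OF lim_1_over_n]] by blast
    then show "\<forall>\<^sub>F n in sequentially. \<forall>x\<in>S. dist (poly (q n) x) (f x) < e"
    proof eventually_elim
      case (elim n)
      then show ?case using q[of _ n] by (auto simp: dist_real_def abs_minus_commute intro: less_trans)
    qed
  qed
  then show thesis by (rule that)
qed

lemma cfc_limit:
  fixes A :: "'h::chilbert_space \<Rightarrow>\<^sub>L 'h"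
  assumes A: "selfadj A" and f: "continuous_on (rspec A) f"
    and q: "uniform_limit (rspec A) (\<lambda>n t. poly (q n) t) f sequentially"
  shows "(\<lambda>n. op_poly (q n) A) \<longlonglongrightarrow> cfc f A"
proof -
  let ?lim = "\<lambda>q. uniform_limit (rspec A) (\<lambda>n t. poly (q n) t) f sequentially"
  have close: "\<exists>N. \<forall>m\<ge>N. \<forall>n\<ge>N. norm (op_poly (q m) A - op_poly (r n) A) \<le> e"
    if q: "?lim q" and r: "?lim r" and e: "e > 0" for q r :: "nat \<Rightarrow> real poly" and e
  proof -
    obtain N1 N2 where N: "\<And>n t. n \<ge> N1 \<Longrightarrow> t \<in> rspec A \<Longrightarrow> dist (poly (q n) t) (f t) < e / 2"
      "\<And>n t. n \<ge> N2 \<Longrightarrow> t \<in> rspec A \<Longrightarrow> dist (poly (r n) t) (f t) < e / 2"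
      using q r e unfolding uniform_limit_sequentially_iff by (metis half_gt_zero)
    have "norm (op_poly (q m) A - op_poly (r n) A) \<le> e"
      if "m \<ge> max N1 N2" "n \<ge> max N1 N2" for m n
      unfolding op_poly_diff[symmetric]
    proof (rule norm_op_poly_le[OF A])
      fix t assume "t \<in> rspec A"
      then show "\<bar>poly (q m - r n) t\<bar> \<le> e"
        using N(1)[of m t] N(2)[of n t] that
        unfolding dist_real_def poly_diff by linarith
    qed (use e in simp)
    then show ?thesis by blast
  qed
  have "Cauchy (\<lambda>n. op_poly (q n) A)"
  proof (rule metric_CauchyI)
    fix e :: real assume "e > 0"
    then obtain N where "\<forall>m\<ge>N. \<forall>n\<ge>N. norm (op_poly (q m) A - op_poly (q n) A) \<le> e / 2"
      using close[OF q q, of "e / 2"] by auto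
    then show "\<exists>M. \<forall>m\<ge>M. \<forall>n\<ge>M. dist (op_poly (q m) A) (op_poly (q n) A) < e"
      using \<open>e > 0\<close> by (intro exI[of _ N]) (force simp: dist_norm)
  qed
  then obtain B where B: "(\<lambda>n. op_poly (q n) A) \<longlonglongrightarrow> B"
    using Cauchy_convergent_iff[of "\<lambda>n. op_poly (q n) A"] unfolding convergent_def by auto
  have all: "(\<lambda>n. op_poly (r n) A) \<longlonglongrightarrow> B" if r: "?lim r" for r
  proof -
    have "(\<lambda>n. op_poly (q n) A - op_poly (r n) A) \<longlonglongrightarrow> 0"
      unfolding LIMSEQ_iff
    proof safe
      fix e :: real assume "e > 0"
      then obtain N where "\<forall>m\<ge>N. \<forall>n\<ge>N. norm (op_poly (q m) A - op_poly (r n) A) \<le> e / 2"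
        using close[OF q r, of "e / 2"] by auto
      then show "\<exists>N. \<forall>n\<ge>N. norm (op_poly (q n) A - op_poly (r n) A - 0) < e"
        using \<open>e > 0\<close> by (intro exI[of _ N]) force
    qed
    from tendsto_diff[OF B this] show ?thesis by simp
  qed
  have "cfc f A = B"
    unfolding cfc_def real_spectrum_eq_rspec[OF A]
  proof (rule the_equality)
    fix C assume "\<forall>q. ?lim q \<longrightarrow> (\<lambda>n. op_poly (q n) A) \<longlonglongrightarrow> C"
    then show "C = B" using B q LIMSEQ_unique by blast
  qed (use all in blast)
  then show ?thesis using B by simp
qed

lemma adj_in_clinear_ops:
  fixes A :: "'h::chilbert_space \<Rightarrow>\<^sub>L 'h"
  assumes A: "A \<in> clinear_ops"
  shows "adj A \<in> clinear_ops"
proof -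
  have "adj A (scaleC c y) = scaleC c (adj A y)" for c y
  proof (rule vector_eq_ldot[THEN iffD1], intro allI)
    fix x
    show "inner x (adj A (scaleC c y)) = inner x (scaleC c (adj A y))"
      by (metis A clinear_opsD complex_cnj_cnj inner_adj inner_scaleC)
  qed
  then show ?thesis by (simp add: clinear_ops_def)
qed

lemma adj_adj: "A \<in> clinear_ops \<Longrightarrow> adj (adj A) = A"
  by (rule adj_unique[OF adj_in_clinear_ops]) (simp, metis inner_adj inner_commute)

lemma adj_diff: "A \<in> clinear_ops \<Longrightarrow> B \<in> clinear_ops \<Longrightarrow> adj (A - B) = adj A - adj B"
  by (rule adj_unique) (simp_all add: clinear_ops_diff blinfun.diff_left inner_diff_left inner_diff_right inner_adj)

lemma adj_compose: "A \<in> clinear_ops \<Longrightarrow> B \<in> clinear_ops \<Longrightarrow> adj (A o\<^sub>L B) = adj B o\<^sub>L adj A"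
  by (rule adj_unique) (simp_all add: clinear_ops_compose inner_adj)

lemma adj_cscale: "A \<in> clinear_ops \<Longrightarrow> adj (cscale c A) = cscale (cnj c) (adj A)"
  by (rule adj_unique)
    (simp_all add: clinear_ops_cscale inner_scaleC inner_adj clinear_opsD[OF adj_in_clinear_ops])

lemma adj_id [simp]: "adj id_blinfun = id_blinfun"
  by (rule adj_unique) simp_all

lemma
  assumes A: "selfadj A" and f: "continuous_on (rspec A) f"
  shows selfadj_cfc: "selfadj (cfc f A)"
    and cfc_in_closure: "cfc f A \<in> closure (range (\<lambda>q. op_poly q A))"
proof -
  obtain q where "uniform_limit (rspec A) (\<lambda>n t. poly (q n) t) f sequentially"
    using polynomial_uniform_approx[OF compact_rspec f] by blast
  then have lim: "(\<lambda>n. op_poly (q n) A) \<longlonglongrightarrow> cfc f A" by (rule cfc_limit[OF A f])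
  then show "selfadj (cfc f A)" by (rule selfadj_limit[rotated]) (rule selfadj_op_poly[OF A])
  show "cfc f A \<in> closure (range (\<lambda>q. op_poly q A))"
    unfolding closure_sequential using lim by (intro exI[of _ "\<lambda>n. op_poly (q n) A"]) auto
qed

lemma cfc_cong:
  assumes A: "selfadj A" and eq: "\<And>t. t \<in> rspec A \<Longrightarrow> f t = g t"
  shows "cfc f A = cfc g A"
proof -
  have "uniform_limit (rspec A) h f sequentially \<longleftrightarrow> uniform_limit (rspec A) h g sequentially" for h
    using eq by (intro uniform_limit_cong') auto
  then show ?thesis unfolding cfc_def real_spectrum_eq_rspec[OF A] by simp
qed

lemma cfc_poly:
  assumes A: "selfadj A" and f: "\<And>t. t \<in> rspec A \<Longrightarrow> f t = poly q t"
  shows "cfc f A = op_poly q A"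
proof -
  have "continuous_on (rspec A) f \<longleftrightarrow> continuous_on (rspec A) (poly q)"
    using f by (intro continuous_on_cong) auto
  then have "continuous_on (rspec A) f" by (simp add: continuous_on_poly)
  moreover have "uniform_limit (rspec A) (\<lambda>n t. poly q t) f sequentially"
    using f by (simp add: uniform_limit_iff)
  ultimately have "(\<lambda>n. op_poly q A) \<longlonglongrightarrow> cfc f A" by (intro cfc_limit[OF A])
  then show ?thesis by (simp add: LIMSEQ_const_iff)
qed

lemma cfc_diff:
  assumes A: "selfadj A" and f: "continuous_on (rspec A) f" and g: "continuous_on (rspec A) g"
  shows "cfc (\<lambda>t. f t - g t) A = cfc f A - cfc g A"
proof -
  obtain q r where q: "uniform_limit (rspec A) (\<lambda>n t. poly (q n) t) f sequentially"
    and r: "uniform_limit (rspec A) (\<lambda>n t. poly (r n) t) g sequentially"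
    using polynomial_uniform_approx[OF compact_rspec] f g by metis
  have "uniform_limit (rspec A) (\<lambda>n t. poly (q n - r n) t) (\<lambda>t. f t - g t) sequentially"
    using uniform_limit_minus[OF q r] by simp
  then have "(\<lambda>n. op_poly (q n - r n) A) \<longlonglongrightarrow> cfc (\<lambda>t. f t - g t) A"
    by (intro cfc_limit[OF A] continuous_intros f g)
  moreover have "(\<lambda>n. op_poly (q n - r n) A) \<longlonglongrightarrow> cfc f A - cfc g A"
    unfolding op_poly_diff by (intro tendsto_intros cfc_limit[OF A] f g q r)
  ultimately show ?thesis by (rule LIMSEQ_unique)
qed

lemma cfc_mult:
  assumes A: "selfadj A" and f: "continuous_on (rspec A) f" and g: "continuous_on (rspec A) g"
  shows "cfc (\<lambda>t. f t * g t) A = cfc f A o\<^sub>L cfc g A"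
proof -
  obtain q r where q: "uniform_limit (rspec A) (\<lambda>n t. poly (q n) t) f sequentially"
    and r: "uniform_limit (rspec A) (\<lambda>n t. poly (r n) t) g sequentially"
    using polynomial_uniform_approx[OF compact_rspec] f g by metis
  have "uniform_limit (rspec A) (\<lambda>n t. poly (q n) t * poly (r n) t) (\<lambda>t. f t * g t) sequentially"
    using q r by (intro uniform_lim_mult compact_imp_bounded compact_continuous_image f g compact_rspec)
  then have "(\<lambda>n. op_poly (q n * r n) A) \<longlonglongrightarrow> cfc (\<lambda>t. f t * g t) A"
    by (intro cfc_limit[OF A] continuous_intros f g) simp
  moreover have "(\<lambda>n. op_poly (q n * r n) A) \<longlonglongrightarrow> (cfc f A o\<^sub>L cfc g A)"
    unfolding op_poly_mult
    by (intro bounded_bilinear.tendsto[OF bounded_bilinear_blinfun_compose] cfc_limit[OF A] f g q r)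
  ultimately show ?thesis by (rule LIMSEQ_unique)
qed

lemma rspec_nonneg:
  fixes A :: "'h::chilbert_space \<Rightarrow>\<^sub>L 'h"
  assumes A: "\<And>x. inner (blinfun_apply A x) x \<ge> 0" and t: "t \<in> rspec A"
  shows "t \<ge> 0"
proof (rule ccontr)
  assume neg: "\<not> t \<ge> 0"
  have "- t * norm x \<le> norm ((A - t *\<^sub>R id_blinfun) x)" for x
  proof -
    have "(- t * norm x) * norm x \<le> inner ((A - t *\<^sub>R id_blinfun) x) x"
      using A[of x] by (simp add: blinfun.diff_left scaleR_blinfun.rep_eq inner_diff_left
          power2_norm_eq_inner[symmetric] power2_eq_square)
    also have "\<dots> \<le> norm ((A - t *\<^sub>R id_blinfun) x) * norm x" by (rule norm_cauchy_schwarz)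
    finally show ?thesis by (cases "x = 0") (simp, rule mult_right_le_imp_le, auto)
  qed
  then have "bounded_below (A - t *\<^sub>R id_blinfun)"
    by (rule bounded_belowI[rotated]) (use neg in simp)
  then show False using t by (simp add: rspec_def)
qed

lemma selfadj_adj_compose: "A \<in> clinear_ops \<Longrightarrow> selfadj (adj A o\<^sub>L A)"
  by (simp add: selfadj_iff clinear_ops_compose adj_in_clinear_ops adj_compose adj_adj)

lemma inner_adj_compose:
  "A \<in> clinear_ops \<Longrightarrow> inner ((adj A o\<^sub>L A) x) x = (norm (blinfun_apply A x))\<^sup>2"
  by (metis blinfun_apply_blinfun_compose inner_adj inner_commute power2_norm_eq_inner)

lemma
  assumes A: "A \<in> clinear_ops"
  shows selfadj_op_abs: "selfadj (op_abs A)"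
    and op_abs_square: "op_abs A o\<^sub>L op_abs A = adj A o\<^sub>L A"
    and rspec_op_abs_nonneg: "t \<in> rspec (op_abs A) \<Longrightarrow> t \<ge> 0"
proof -
  let ?B = "adj A o\<^sub>L A"
  have B: "selfadj ?B" using A by (rule selfadj_adj_compose)
  have nonneg: "t \<ge> 0" if "t \<in> rspec ?B" for t
    using that by (rule rspec_nonneg[rotated]) (simp add: inner_adj_compose[OF A] del: blinfun_apply_blinfun_compose)
  have sqrt: "continuous_on (rspec ?B) sqrt" "continuous_on (rspec ?B) (\<lambda>t. sqrt (sqrt t))"
    by (auto intro!: continuous_intros)
  show "selfadj (op_abs A)" unfolding op_abs_def using B sqrt(1) by (rule selfadj_cfc)
  have "op_abs A o\<^sub>L op_abs A = op_poly [:0, 1:] ?B"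
    unfolding op_abs_def cfc_mult[OF B sqrt(1) sqrt(1), symmetric]
    by (rule cfc_poly[OF B]) (simp add: nonneg)
  then show "op_abs A o\<^sub>L op_abs A = ?B" by (simp only: op_poly_X)
  define D where "D = cfc (\<lambda>t. sqrt (sqrt t)) ?B"
  have D: "selfadj D" unfolding D_def using B sqrt(2) by (rule selfadj_cfc)
  have "D o\<^sub>L D = cfc (\<lambda>t. sqrt (sqrt t) * sqrt (sqrt t)) ?B"
    unfolding D_def cfc_mult[OF B sqrt(2) sqrt(2)] ..
  also have "\<dots> = op_abs A"
    unfolding op_abs_def by (rule cfc_cong[OF B]) (simp add: nonneg)
  finally have "D o\<^sub>L D = op_abs A" .
  then have "op_abs A x = D (D x)" for x by (metis blinfun_apply_blinfun_compose)
  then have pos: "inner (op_abs A x) x = (norm (D x))\<^sup>2" for x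
    using D by (simp add: selfadj_def power2_norm_eq_inner)
  show "t \<ge> 0" if "t \<in> rspec (op_abs A)"
    using that by (rule rspec_nonneg[rotated]) (simp add: pos)
qed

lemma norm_op_abs_le:
  assumes A: "A \<in> clinear_ops"
  shows "norm (op_abs A) \<le> norm A"
proof (rule norm_blinfun_bound)
  fix x
  let ?C = "op_abs A"
  have "(norm (?C x))\<^sup>2 = inner ((?C o\<^sub>L ?C) x) x"
    using selfadj_op_abs[OF A] by (simp add: selfadj_def power2_norm_eq_inner)
  also have "\<dots> = (norm (A x))\<^sup>2"
    unfolding op_abs_square[OF A] by (rule inner_adj_compose[OF A])
  finally have "norm (?C x) = norm (A x)" by simp
  then show "norm (?C x) \<le> norm A * norm x" by (metis norm_blinfun)
qed simp

lemma commutant_clinear: "B \<in> commutant S \<Longrightarrow> B \<in> clinear_ops"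
  by (simp add: commutant_def)

lemma commutant_memD: "B \<in> commutant S \<Longrightarrow> A \<in> S \<Longrightarrow> A o\<^sub>L B = B o\<^sub>L A"
  by (simp add: commutant_def)

lemma closed_commutant: "closed (commutant S)"
  unfolding closed_sequential_limits
proof safe
  fix X B assume X: "\<forall>n. X n \<in> commutant S" and lim: "X \<longlonglongrightarrow> B"
  have "B \<in> clinear_ops"
    using closed_clinear_ops X lim unfolding closed_sequential_limits commutant_def by blast
  moreover have "A o\<^sub>L B = B o\<^sub>L A" if "A \<in> S" for A
  proof (rule LIMSEQ_unique)
    show "(\<lambda>n. A o\<^sub>L X n) \<longlonglongrightarrow> (A o\<^sub>L B)"
      by (intro bounded_bilinear.tendsto[OF bounded_bilinear_blinfun_compose] tendsto_const lim)
    have "(\<lambda>n. X n o\<^sub>L A) \<longlonglongrightarrow> (B o\<^sub>L A)"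
      by (intro bounded_bilinear.tendsto[OF bounded_bilinear_blinfun_compose] tendsto_const lim)
    then show "(\<lambda>n. A o\<^sub>L X n) \<longlonglongrightarrow> (B o\<^sub>L A)"
      using commutant_memD[of "X _" S A] X that by simp
  qed
  ultimately show "B \<in> commutant S" by (simp add: commutant_def)
qed

locale tracial_algebra =
  fixes N :: "('h::chilbert_space \<Rightarrow>\<^sub>L 'h) set" and \<tau> :: "('h \<Rightarrow>\<^sub>L 'h) \<Rightarrow> complex"
  assumes vN: "von_neumann_algebra N" and trace: "tracial_state N \<tau>"
begin

lemma clinear: "A \<in> N \<Longrightarrow> A \<in> clinear_ops"
  using vN by (auto simp: von_neumann_algebra_def)

lemma N_eq: "N = commutant (commutant N)"
  using vN by (simp add: von_neumann_algebra_def)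

lemma N_adj: "A \<in> N \<Longrightarrow> adj A \<in> N"
  using vN by (simp add: von_neumann_algebra_def)

lemma N_iff: "A \<in> N \<longleftrightarrow> A \<in> clinear_ops \<and> (\<forall>B\<in>commutant N. B o\<^sub>L A = A o\<^sub>L B)"
  by (subst N_eq) (simp add: commutant_def)

lemma N_id [simp]: "id_blinfun \<in> N"
  by (simp add: N_iff)

lemma N_add: "A \<in> N \<Longrightarrow> B \<in> N \<Longrightarrow> A + B \<in> N"
  by (simp add: N_iff clinear_ops_add compose_bilinear)

lemma N_diff: "A \<in> N \<Longrightarrow> B \<in> N \<Longrightarrow> A - B \<in> N"
  by (simp add: N_iff clinear_ops_diff compose_bilinear)

lemma N_scaleR: "A \<in> N \<Longrightarrow> r *\<^sub>R A \<in> N"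
  by (simp add: N_iff clinear_ops_scaleR compose_bilinear)

lemma N_cscale: "A \<in> N \<Longrightarrow> cscale c A \<in> N"
  by (simp add: N_iff clinear_ops_cscale cscale_compose_left cscale_compose_right commutant_clinear)

lemma N_compose: "A \<in> N \<Longrightarrow> B \<in> N \<Longrightarrow> A o\<^sub>L B \<in> N"
  unfolding N_iff by (metis clinear_ops_compose compose_assoc)

lemma N_op_poly: "A \<in> N \<Longrightarrow> op_poly q A \<in> N"
proof (induction q rule: pCons_induct)
  case 0
  show ?case using N_scaleR[OF N_id, of 0] by simp
next
  case (pCons a q)
  then show ?case by (simp add: op_poly_pCons N_add N_scaleR N_compose)
qed

lemma N_cfc:
  assumes "A \<in> N" "selfadj A" "continuous_on (rspec A) f"
  shows "cfc f A \<in> N"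
proof -
  have "closed N" by (subst N_eq) (rule closed_commutant)
  then have "closure (range (\<lambda>q. op_poly q A)) \<subseteq> N"
    by (rule closure_minimal[rotated]) (use assms(1) in \<open>auto intro: N_op_poly\<close>)
  then show ?thesis using cfc_in_closure[OF assms(2,3)] by blast
qed

lemma N_op_abs: "A \<in> N \<Longrightarrow> op_abs A \<in> N"
  unfolding op_abs_def
  by (intro N_cfc N_compose N_adj selfadj_adj_compose clinear continuous_intros) auto

lemma trace_add: "A \<in> N \<Longrightarrow> B \<in> N \<Longrightarrow> \<tau> (A + B) = \<tau> A + \<tau> B"
  and trace_cscale: "A \<in> N \<Longrightarrow> \<tau> (cscale c A) = c * \<tau> A"
  and trace_commute: "A \<in> N \<Longrightarrow> B \<in> N \<Longrightarrow> \<tau> (A o\<^sub>L B) = \<tau> (B o\<^sub>L A)"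
  and trace_id [simp]: "\<tau> id_blinfun = 1"
  and trace_pos: "A \<in> N \<Longrightarrow> 0 \<le> Re (\<tau> (adj A o\<^sub>L A))"
  using trace by (auto simp: tracial_state_def)

lemma trace_faithful:
  assumes "A \<in> N" "Re (\<tau> (adj A o\<^sub>L A)) \<le> 0"
  shows "A = 0"
proof -
  have "\<tau> (adj A o\<^sub>L A) \<in> \<real>" using trace assms(1) by (auto simp: tracial_state_def)
  then have "\<tau> (adj A o\<^sub>L A) = 0"
    using trace_pos[OF assms(1)] assms(2) by (auto simp: complex_eq_iff complex_is_Real_iff)
  then show ?thesis using trace assms(1) by (auto simp: tracial_state_def)
qed

lemma trace_scaleR: "A \<in> N \<Longrightarrow> \<tau> (r *\<^sub>R A) = of_real r * \<tau> A"
  by (metis cscale_of_real trace_cscale)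

lemma trace_diff: "A \<in> N \<Longrightarrow> B \<in> N \<Longrightarrow> \<tau> (A - B) = \<tau> A - \<tau> B"
  using trace_add[of A "(-1) *\<^sub>R B"] trace_scaleR[of B "-1"] N_scaleR[of B "-1"] by simp

lemma trace_cfc_mono:
  assumes A: "A \<in> N" "selfadj A"
    and f: "continuous_on (rspec A) f" and g: "continuous_on (rspec A) g"
    and le: "\<And>t. t \<in> rspec A \<Longrightarrow> f t \<le> g t"
  shows "Re (\<tau> (cfc f A)) \<le> Re (\<tau> (cfc g A))"
proof -
  let ?h = "\<lambda>t. sqrt (g t - f t)"
  define G where "G = cfc ?h A"
  have h: "continuous_on (rspec A) ?h" by (intro continuous_intros f g)
  have G: "G \<in> N" "selfadj G" unfolding G_def using A h by (auto intro: N_cfc selfadj_cfc)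
  have "adj G o\<^sub>L G = cfc (\<lambda>t. ?h t * ?h t) A"
    using G(2) cfc_mult[OF A(2) h h] by (simp add: selfadj_iff G_def)
  also have "\<dots> = cfc (\<lambda>t. g t - f t) A"
    by (rule cfc_cong[OF A(2)]) (simp add: le)
  also have "\<dots> = cfc g A - cfc f A" by (rule cfc_diff[OF A(2) g f])
  finally show ?thesis
    using trace_pos[OF G(1)] A f g by (simp add: trace_diff N_cfc)
qed

end

section \<open>p-norms and symmetries\<close>

lemma powr_le_tangent:
  fixes q u :: real
  assumes q: "0 < q" "q < 1" and u: "u \<ge> 0"
  shows "u powr q \<le> 1 + q * (u - 1)"
proof (cases "u = 0")
  case False
  have "u powr q * 1 powr (1 - q) \<le> q * u + (1 - q) * 1"
    using q u False by (intro Youngs_inequality_0) auto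
  then show ?thesis by (simp add: algebra_simps)
qed (use q in simp)

lemma powr_ge_tangent:
  fixes q u :: real
  assumes q: "q > 1" and u: "u \<ge> 0"
  shows "u powr q \<ge> 1 + q * (u - 1)"
proof -
  have "(u powr q) powr (1 / q) \<le> 1 + 1 / q * (u powr q - 1)"
    using q by (intro powr_le_tangent) auto
  then show ?thesis using q u by (simp add: powr_powr field_simps)
qed

text \<open>The next two bounds are sharp at \<open>s = 0\<close> and \<open>s = 1\<close>, and their linear and quadratic
  coefficients add up to 1. Adding them at \<open>s\<close> and \<open>1 - s\<close> therefore compares \<open>s\<^sup>q + (1 - s)\<^sup>q\<close> with 1,
  with an error that is a multiple of \<open>s (1 - s)\<close>.\<close>

lemma powr_ge_quadratic:
  fixes q s :: real
  assumes q: "0 < q" "q < 1" and s: "0 \<le> s"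
  shows "s powr q \<ge> (2 - q) * s + (q - 1) * s\<^sup>2"
proof (cases "s = 0")
  case False
  then have s: "s > 0" using s by simp
  define x where "x = (1 - q) * (s - 1)"
  have "s powr (1 - q) \<le> 1 + x"
    unfolding x_def using q s by (intro powr_le_tangent) auto
  moreover have "0 < s powr (1 - q)" using s by simp
  ultimately have x: "1 + x > 0" "1 / (1 + x) \<le> 1 / s powr (1 - q)"
    by (linarith, intro frac_le) auto
  have "(1 - x) * (1 + x) \<le> 1" by (simp add: algebra_simps)
  then have "1 - x \<le> 1 / (1 + x)" using x(1) by (simp add: pos_le_divide_eq)
  also have "\<dots> \<le> s powr (q - 1)" using x(2) by (simp add: powr_minus_divide[symmetric])
  finally have "s * (1 - x) \<le> s * s powr (q - 1)" using s by simp
  also have "\<dots> = s powr q" using s by (simp add: powr_mult_base)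
  finally show ?thesis by (simp add: x_def algebra_simps power2_eq_square)
qed simp

lemma powr_le_quadratic:
  fixes q s :: real
  assumes q: "q > 1" and s: "0 \<le> s" "s \<le> 1"
  defines "c \<equiv> min 1 (q - 1)"
  shows "s powr q \<le> (1 - c) * s + c * s\<^sup>2"
proof (cases "s = 0")
  case False
  show ?thesis
  proof (cases "q < 2")
    case True
    have "s powr (q - 1) \<le> 1 + (q - 1) * (s - 1)"
      using True q s by (intro powr_le_tangent) auto
    then have "s * s powr (q - 1) \<le> s * (1 + (q - 1) * (s - 1))"
      using s by (intro mult_left_mono)
    moreover have "s * s powr (q - 1) = s powr q" using False s by (simp add: powr_mult_base)
    ultimately show ?thesis
      using True by (simp add: c_def min_def algebra_simps power2_eq_square)
  next
    case ge: False
    then have "s powr q \<le> s powr 2" using False s by (intro powr_mono') auto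
    then show ?thesis using False ge s by (simp add: c_def)
  qed
qed simp

lemma powr_eq_square_powr_half:
  fixes k t p :: real
  assumes "t \<ge> 0" "k > 0"
  shows "t powr p = k powr p * ((t / k)\<^sup>2) powr (p / 2)"
proof (cases "t = 0")
  case False
  have "((t / k)\<^sup>2) powr (p / 2) = (t / k) powr p"
    using False assms by (simp add: powr_powr flip: powr_numeral)
  then show ?thesis using assms by (simp add: powr_divide)
qed simp

context tracial_algebra
begin

definition Lp_mass :: "real \<Rightarrow> ('h \<Rightarrow>\<^sub>L 'h) \<Rightarrow> real" where
  "Lp_mass p A = Re (\<tau> (op_powr (op_abs A) p))"

lemma
  assumes A: "A \<in> N" and p: "p > 0"
  defines "B \<equiv> adj A o\<^sub>L A"
  shows Lp_mass_le: "(\<And>t. t \<in> rspec (op_abs A) \<Longrightarrow> t powr p \<le> a + b * t\<^sup>2 + c * t ^ 4) \<Longrightarrow>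
      Lp_mass p A \<le> a + b * Re (\<tau> B) + c * Re (\<tau> (B o\<^sub>L B))"
    and Lp_mass_ge: "(\<And>t. t \<in> rspec (op_abs A) \<Longrightarrow> t powr p \<ge> a + b * t\<^sup>2 + c * t ^ 4) \<Longrightarrow>
      Lp_mass p A \<ge> a + b * Re (\<tau> B) + c * Re (\<tau> (B o\<^sub>L B))"
proof -
  let ?C = "op_abs A" and ?r = "[:a, 0, b, 0, c:]"
  note C = N_op_abs[OF A] selfadj_op_abs[OF clinear[OF A]]
  have cont: "continuous_on (rspec ?C) (\<lambda>t. t powr p)" "continuous_on (rspec ?C) (poly ?r)"
    using p rspec_op_abs_nonneg[OF clinear[OF A]] by (auto intro!: continuous_intros continuous_on_powr')
  have B: "B \<in> N" unfolding B_def by (intro N_compose N_adj A)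
  have sq: "?C o\<^sub>L ?C = B" unfolding B_def by (rule op_abs_square[OF clinear[OF A]])
  then have sq': "?C o\<^sub>L (?C o\<^sub>L D) = B o\<^sub>L D" for D by (metis compose_assoc)
  have "cfc (poly ?r) ?C = op_poly ?r ?C" by (rule cfc_poly[OF C(2)]) simp
  also have "\<dots> = a *\<^sub>R id_blinfun + b *\<^sub>R B + c *\<^sub>R (B o\<^sub>L B)"
    by (simp add: op_poly_pCons compose_bilinear sq sq')
  finally have val: "Re (\<tau> (cfc (poly ?r) ?C)) = a + b * Re (\<tau> B) + c * Re (\<tau> (B o\<^sub>L B))"
    using B by (simp add: trace_add trace_scaleR N_add N_scaleR N_compose)
  have r: "poly ?r t = a + b * t\<^sup>2 + c * t ^ 4" for t
    by (simp add: algebra_simps power2_eq_square power4_eq_xxxx)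
  show "Lp_mass p A \<le> a + b * Re (\<tau> B) + c * Re (\<tau> (B o\<^sub>L B))"
    if "\<And>t. t \<in> rspec (op_abs A) \<Longrightarrow> t powr p \<le> a + b * t\<^sup>2 + c * t ^ 4"
    using trace_cfc_mono[OF C cont] that unfolding val r Lp_mass_def op_powr_def by blast
  show "Lp_mass p A \<ge> a + b * Re (\<tau> B) + c * Re (\<tau> (B o\<^sub>L B))"
    if "\<And>t. t \<in> rspec (op_abs A) \<Longrightarrow> t powr p \<ge> a + b * t\<^sup>2 + c * t ^ 4"
    using trace_cfc_mono[OF C cont(2,1)] that unfolding val r Lp_mass_def op_powr_def by blast
qed

lemma Lp_mass_eq_of_Lp_norm_eq:
  assumes "A \<in> N" "B \<in> N" "p > 0" "Lp_norm \<tau> p A = Lp_norm \<tau> p B"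
  shows "Lp_mass p A = Lp_mass p B"
proof -
  have nonneg: "Lp_mass p A \<ge> 0" if "A \<in> N" for A
    using Lp_mass_ge[OF that assms(3), of 0 0 0] by simp
  have "(Lp_norm \<tau> p A) powr p = Lp_mass p A" if "A \<in> N" for A
    using assms(3) nonneg[OF that] by (simp add: Lp_norm_def Lp_mass_def[symmetric] powr_powr)
  then show ?thesis using assms by metis
qed

lemma rspec_op_abs_annihilator:
  assumes A: "A \<in> N" and t: "t \<in> rspec (op_abs A)"
    and B: "a *\<^sub>R id_blinfun + b *\<^sub>R (adj A o\<^sub>L A) + c *\<^sub>R ((adj A o\<^sub>L A) o\<^sub>L (adj A o\<^sub>L A)) = 0"
  shows "a + b * t\<^sup>2 + c * t ^ 4 = 0"
proof -
  let ?C = "op_abs A" and ?r = "[:a, 0, b, 0, c:]"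
  have sq: "?C o\<^sub>L ?C = adj A o\<^sub>L A" by (rule op_abs_square[OF clinear[OF A]])
  then have sq': "?C o\<^sub>L (?C o\<^sub>L D) = (adj A o\<^sub>L A) o\<^sub>L D" for D by (metis compose_assoc)
  have "op_poly ?r ?C = 0"
    using B by (simp add: op_poly_pCons compose_bilinear sq sq' add.assoc)
  from rspec_annihilator[OF this t] show ?thesis
    by (simp add: algebra_simps power2_eq_square power4_eq_xxxx)
qed

lemma Lp_mass_scalar:
  assumes A: "A \<in> N" and p: "p > 0" and k: "k > 0" and B: "adj A o\<^sub>L A = k\<^sup>2 *\<^sub>R id_blinfun"
  shows "Lp_mass p A = k powr p"
proof -
  have t: "t = k" if "t \<in> rspec (op_abs A)" for t
  proof -
    have "- k\<^sup>2 + 1 * t\<^sup>2 + 0 * t ^ 4 = 0"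
      by (rule rspec_op_abs_annihilator[OF A that]) (simp add: B)
    then show ?thesis
      using rspec_op_abs_nonneg[OF clinear[OF A] that] k by (simp add: power2_eq_iff_nonneg)
  qed
  show ?thesis
    using Lp_mass_le[OF A p, of "k powr p" 0 0] Lp_mass_ge[OF A p, of "k powr p" 0 0] t by force
qed

definition symmetry :: "('h \<Rightarrow>\<^sub>L 'h) \<Rightarrow> bool" where
  "symmetry U \<longleftrightarrow> U \<in> N \<and> adj U = U \<and> U o\<^sub>L U = id_blinfun"

lemma adj_compose_scaled_symmetries:
  assumes W: "symmetry W" and U: "symmetry U" and \<alpha>: "cmod \<alpha> = 1" and \<beta>: "cmod \<beta> = 1"
  defines "A \<equiv> cscale \<alpha> W - cscale \<beta> U"
  shows "adj A o\<^sub>L A = 2 *\<^sub>R id_blinfun - cscale (cnj \<alpha> * \<beta>) (W o\<^sub>L U) - cscale (\<alpha> * cnj \<beta>) (U o\<^sub>L W)"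
proof -
  have cl: "W \<in> clinear_ops" "U \<in> clinear_ops" using W U clinear by (auto simp: symmetry_def)
  have "adj A = cscale (cnj \<alpha>) W - cscale (cnj \<beta>) U"
    using W U cl by (simp add: A_def adj_diff adj_cscale clinear_ops_cscale symmetry_def)
  moreover have "cnj \<alpha> * \<alpha> = 1" "cnj \<beta> * \<beta> = 1"
    using \<alpha> \<beta> complex_norm_square[of \<alpha>] complex_norm_square[of \<beta>] by (simp_all add: mult.commute)
  ultimately show ?thesis
    using W U cl
    by (simp add: A_def symmetry_def compose_bilinear cscale_compose_left cscale_compose_right
        clinear_ops_cscale cscale_cscale mult.commute scaleR_2)
qed

lemma trace_scaled_symmetries:
  assumes W: "symmetry W" and U: "symmetry U" and \<alpha>: "cmod \<alpha> = 1" and \<beta>: "cmod \<beta> = 1"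
  defines "A \<equiv> cscale \<alpha> W - cscale \<beta> U"
  shows "Re (\<tau> (adj A o\<^sub>L A)) = 2 - 2 * Re (\<alpha> * cnj \<beta>) * Re (\<tau> (U o\<^sub>L W))"
proof -
  have N: "W \<in> N" "U \<in> N" using W U by (auto simp: symmetry_def)
  have "\<tau> (adj A o\<^sub>L A) = 2 - (cnj \<alpha> * \<beta> + \<alpha> * cnj \<beta>) * \<tau> (U o\<^sub>L W)"
    unfolding A_def adj_compose_scaled_symmetries[OF assms(1-4)]
    using N by (simp add: trace_diff trace_scaleR trace_cscale N_diff N_scaleR N_cscale N_compose
        trace_commute[of W U]) (simp add: algebra_simps)
  also have "cnj \<alpha> * \<beta> + \<alpha> * cnj \<beta> = complex_of_real (2 * Re (\<alpha> * cnj \<beta>))"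
    by (simp add: complex_eq_iff)
  finally show ?thesis by simp
qed

lemma symmetries_eq:
  assumes W: "symmetry W" and U: "symmetry U" and \<alpha>: "cmod \<alpha> = 1" and \<beta>: "cmod \<beta> = 1"
    and p: "p > 0"
    and sign: "p < 2 \<and> Re (\<alpha> * cnj \<beta>) < 0 \<or> p > 2 \<and> 0 < Re (\<alpha> * cnj \<beta>) \<and> Re (\<alpha> * cnj \<beta>) < 1"
    and eq: "Lp_norm \<tau> p (cscale \<alpha> W - cscale \<beta> U) = Lp_norm \<tau> p (cscale \<alpha> U - cscale \<beta> U)"
  shows "W = U"
proof -
  define \<kappa> where "\<kappa> = Re (\<alpha> * cnj \<beta>)"
  define x where "x = Re (\<tau> (U o\<^sub>L W))"
  define k where "k = sqrt (2 - 2 * \<kappa>)"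
  define A where "A = cscale \<alpha> W - cscale \<beta> U"
  have k2: "k\<^sup>2 = 2 - 2 * \<kappa>" and k: "k > 0" using sign by (auto simp: k_def \<kappa>_def)
  have N: "W \<in> N" "U \<in> N" "A \<in> N" using W U by (auto simp: A_def symmetry_def N_diff N_cscale)
  have "Lp_mass p A = Lp_mass p (cscale \<alpha> U - cscale \<beta> U)"
    unfolding A_def using N p eq by (intro Lp_mass_eq_of_Lp_norm_eq N_diff N_cscale)
  also have "\<dots> = k powr p"
  proof (rule Lp_mass_scalar[OF _ p k])
    have "cscale (cnj \<alpha> * \<beta>) id_blinfun + cscale (\<alpha> * cnj \<beta>) id_blinfun
        = (2 * \<kappa>) *\<^sub>R (id_blinfun :: 'h \<Rightarrow>\<^sub>L 'h)"
      unfolding cscale_add_left[symmetric] cscale_of_real[symmetric]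
      by (rule arg_cong[of _ _ "\<lambda>c. cscale c _"]) (simp add: \<kappa>_def complex_eq_iff)
    then show "adj (cscale \<alpha> U - cscale \<beta> U) o\<^sub>L (cscale \<alpha> U - cscale \<beta> U) = k\<^sup>2 *\<^sub>R id_blinfun"
      unfolding adj_compose_scaled_symmetries[OF U U \<alpha> \<beta>] k2
      using U by (simp add: symmetry_def scaleR_diff_left diff_diff_eq)
  qed (use N in \<open>auto intro: N_diff N_cscale\<close>)
  finally have mass: "Lp_mass p A = k powr p" .
  have B: "Re (\<tau> (adj A o\<^sub>L A)) = 2 - 2 * \<kappa> * x"
    unfolding A_def \<kappa>_def x_def by (rule trace_scaled_symmetries[OF W U \<alpha> \<beta>])
  have tangent: "k powr p * (1 + p / 2 * ((t / k)\<^sup>2 - 1))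
      = k powr p * (1 - p / 2) + (k powr p * (p / 2) / k\<^sup>2) * t\<^sup>2 + 0 * t ^ 4" for t
    by (simp add: field_simps)
  have nonneg: "t \<ge> 0" if "t \<in> rspec (op_abs A)" for t
    using rspec_op_abs_nonneg[OF clinear[OF N(3)] that] .
  define bound where "bound = k powr p * (1 - p / 2) + (k powr p * (p / 2) / k\<^sup>2) * (2 - 2 * \<kappa> * x)"
  define m where "m = k powr p * (p / 2) / k\<^sup>2"
  have m: "k powr p * (p / 2) = m * (2 - 2 * \<kappa>)"
    using k unfolding m_def k2[symmetric] by simp
  have bound: "bound = k powr p + m * (2 * \<kappa> * (1 - x))"
  proof -
    have "bound = k powr p - k powr p * (p / 2) + m * (2 - 2 * \<kappa> * x)"
      by (simp add: bound_def m_def algebra_simps)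
    then show ?thesis unfolding m by (simp add: algebra_simps)
  qed
  have coef: "m > 0" using k p by (simp add: m_def)
  have x: "x \<ge> 1"
    using sign[folded \<kappa>_def]
  proof
    assume s: "p < 2 \<and> \<kappa> < 0"
    have "Lp_mass p A \<le> bound"
      unfolding bound_def B[symmetric]
    proof (rule order_trans[OF Lp_mass_le[OF N(3) p]])
      fix t assume t: "t \<in> rspec (op_abs A)"
      show "t powr p \<le> k powr p * (1 - p / 2) + (k powr p * (p / 2) / k\<^sup>2) * t\<^sup>2 + 0 * t ^ 4"
        unfolding tangent[symmetric] powr_eq_square_powr_half[OF nonneg[OF t] k]
        using s p k by (intro mult_left_mono powr_le_tangent) auto
    qed simp
    then have "0 \<le> 2 * \<kappa> * (1 - x)"
      unfolding mass bound using coef by (simp add: zero_le_mult_iff)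
    then show ?thesis using s by (auto simp: zero_le_mult_iff)
  next
    assume s: "p > 2 \<and> 0 < \<kappa> \<and> \<kappa> < 1"
    have "Lp_mass p A \<ge> bound"
      unfolding bound_def B[symmetric]
    proof (rule order_trans[OF _ Lp_mass_ge[OF N(3) p]])
      fix t assume t: "t \<in> rspec (op_abs A)"
      show "t powr p \<ge> k powr p * (1 - p / 2) + (k powr p * (p / 2) / k\<^sup>2) * t\<^sup>2 + 0 * t ^ 4"
        unfolding tangent[symmetric] powr_eq_square_powr_half[OF nonneg[OF t] k]
        using s p k by (intro mult_left_mono powr_ge_tangent) auto
    qed simp
    then have "2 * \<kappa> * (1 - x) \<le> 0"
      unfolding mass bound using coef by (simp add: mult_le_0_iff)
    then show ?thesis using s by (auto simp: mult_le_0_iff)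
  qed
  have "Re (\<tau> (adj (W - U) o\<^sub>L (W - U))) = 2 - 2 * x"
    using trace_scaled_symmetries[OF W U, of 1 1] by (simp add: x_def)
  then have "W - U = 0" using x N by (intro trace_faithful N_diff) auto
  then show ?thesis by simp
qed

lemma unitary_group_norm_le:
  assumes V: "V \<in> unitary_group N"
  shows "norm V \<le> 1"
proof (rule norm_blinfun_bound)
  fix x
  have V': "V \<in> clinear_ops" "adj V o\<^sub>L V = id_blinfun"
    using V clinear by (auto simp: unitary_group_def)
  have "(norm (V x))\<^sup>2 = (norm x)\<^sup>2"
    using inner_adj_compose[OF V'(1), of x] unfolding V'(2) by (simp add: power2_norm_eq_inner)
  then show "norm (V x) \<le> 1 * norm x" by simp
qed simp

lemma unitary_group_cscale:
  assumes U: "U \<in> unitary_group N" and \<alpha>: "cmod \<alpha> = 1"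
  shows "cscale \<alpha> U \<in> unitary_group N"
proof -
  have "cnj \<alpha> * \<alpha> = 1" "\<alpha> * cnj \<alpha> = 1"
    using \<alpha> complex_norm_square[of \<alpha>] by (simp_all add: mult.commute)
  then show ?thesis
    using U clinear
    by (auto simp: unitary_group_def N_cscale adj_cscale cscale_compose_left cscale_compose_right
        adj_in_clinear_ops cscale_cscale)
qed

lemma symmetry_unitary: "symmetry U \<longleftrightarrow> U \<in> unitary_group N \<and> adj U = U"
  by (auto simp: symmetry_def unitary_group_def)

lemma symmetry_id: "symmetry id_blinfun"
  by (simp add: symmetry_def)

lemma symmetry_uminus: "symmetry U \<Longrightarrow> symmetry (- U)"
  using N_scaleR[of U "-1"] adj_cscale[of U "-1"] clinear[of U]
  by (auto simp: symmetry_def compose_bilinear cscale_minus_left)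

lemma cscale_symmetry_square_diff:
  assumes U: "symmetry U" and \<alpha>: "cmod \<alpha> = 1" and s: "s = 1 \<or> s = (- 1 :: real)"
  defines "A \<equiv> cscale \<alpha> U - cscale (s * \<alpha>) id_blinfun"
  shows "adj A o\<^sub>L A = 2 *\<^sub>R id_blinfun - (2 * s) *\<^sub>R U"
proof -
  have \<alpha>2: "cnj \<alpha> * \<alpha> = 1" "\<alpha> * cnj \<alpha> = 1"
    using \<alpha> complex_norm_square[of \<alpha>] by (simp_all add: mult.commute)
  have "cmod (s * \<alpha>) = 1" using \<alpha> s by (auto simp: norm_mult)
  from adj_compose_scaled_symmetries[OF U symmetry_id \<alpha> this]
  have "adj A o\<^sub>L A = 2 *\<^sub>R id_blinfun - cscale (cnj \<alpha> * (s * \<alpha>)) U - cscale (\<alpha> * cnj (s * \<alpha>)) U"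
    by (simp add: A_def)
  moreover have "cnj \<alpha> * (s * \<alpha>) = of_real s" "\<alpha> * cnj (s * \<alpha>) = of_real s"
    using \<alpha>2 by (simp_all add: mult_ac)
  ultimately have "adj A o\<^sub>L A = 2 *\<^sub>R id_blinfun - s *\<^sub>R U - s *\<^sub>R U"
    by (simp only: cscale_of_real)
  moreover have "(2 * s) *\<^sub>R U = s *\<^sub>R U + s *\<^sub>R U" by (simp flip: scaleR_add_left)
  ultimately show ?thesis by simp
qed

lemma Lp_mass_symmetry_diff:
  assumes U: "symmetry U" and \<alpha>: "cmod \<alpha> = 1" and s: "s = 1 \<or> s = (- 1 :: real)" and p: "p > 0"
  shows "Lp_mass p (cscale \<alpha> U - cscale (s * \<alpha>) id_blinfun) = 2 powr p * (1 - s * Re (\<tau> U)) / 2"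
proof -
  define A where "A = cscale \<alpha> U - cscale (s * \<alpha>) id_blinfun"
  have U': "U \<in> N" "U o\<^sub>L U = id_blinfun" using U by (auto simp: symmetry_def)
  have A: "A \<in> N" unfolding A_def using U' by (intro N_diff N_cscale N_id)
  have B: "adj A o\<^sub>L A = 2 *\<^sub>R id_blinfun - (2 * s) *\<^sub>R U"
    unfolding A_def by (rule cscale_symmetry_square_diff[OF U \<alpha> s])
  have "s * (s * 4) = 4" using s by auto
  moreover have "8 *\<^sub>R id_blinfun = 4 *\<^sub>R id_blinfun + 4 *\<^sub>R (id_blinfun :: 'h \<Rightarrow>\<^sub>L 'h)"
    and "(s * 8) *\<^sub>R U = (s * 4) *\<^sub>R U + (s * 4) *\<^sub>R U"
    by (simp_all flip: scaleR_add_left)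
  ultimately have "(adj A o\<^sub>L A) o\<^sub>L (adj A o\<^sub>L A) = 4 *\<^sub>R (adj A o\<^sub>L A)"
    unfolding B by (simp only: compose_bilinear U'(2) compose_id scaleR_scaleR) (simp add: algebra_simps)
  then have ann: "0 *\<^sub>R id_blinfun + (-4) *\<^sub>R (adj A o\<^sub>L A) + 1 *\<^sub>R ((adj A o\<^sub>L A) o\<^sub>L (adj A o\<^sub>L A)) = 0"
    by simp
  have t: "t powr p = 0 + 2 powr p / 4 * t\<^sup>2 + 0 * t ^ 4" if t: "t \<in> rspec (op_abs A)" for t
  proof -
    have "t\<^sup>2 * ((t - 2) * (t + 2)) = 0"
      using rspec_op_abs_annihilator[OF A t ann] by (simp add: algebra_simps power2_eq_square power4_eq_xxxx)
    then have "t = 0 \<or> t = 2" using rspec_op_abs_nonneg[OF clinear[OF A] t] by auto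
    then show ?thesis using p by auto
  qed
  have "Lp_mass p A = 0 + 2 powr p / 4 * Re (\<tau> (adj A o\<^sub>L A)) + 0 * Re (\<tau> ((adj A o\<^sub>L A) o\<^sub>L (adj A o\<^sub>L A)))"
    using Lp_mass_le[OF A p, of 0 "2 powr p / 4" 0] Lp_mass_ge[OF A p, of 0 "2 powr p / 4" 0] t
    by (intro antisym) auto
  also have "Re (\<tau> (adj A o\<^sub>L A)) = 2 - 2 * s * Re (\<tau> U)"
    unfolding B using U' by (simp add: trace_diff trace_scaleR N_scaleR)
  finally show ?thesis by (simp add: A_def field_simps)
qed

lemma scaled_symmetry_if_Lp_norm_eq:
  assumes V: "V \<in> unitary_group N" and U: "symmetry U" and \<alpha>: "cmod \<alpha> = 1"
    and p: "p > 0" "p \<noteq> 2"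
    and eq: "\<And>s. s = 1 \<or> s = (- 1 :: real) \<Longrightarrow>
      Lp_norm \<tau> p (V - cscale (s * \<alpha>) id_blinfun) =
      Lp_norm \<tau> p (cscale \<alpha> U - cscale (s * \<alpha>) id_blinfun)"
  shows "symmetry (cscale (cnj \<alpha>) V)"
proof -
  define Z where "Z = cscale (cnj \<alpha>) V"
  define H where "H = Z + adj Z"
  define A where "A s = V - cscale (s * \<alpha>) id_blinfun" for s :: real
  have \<alpha>2: "cnj \<alpha> * \<alpha> = 1" "\<alpha> * cnj \<alpha> = 1"
    using \<alpha> complex_norm_square[of \<alpha>] by (simp_all add: mult.commute)
  have Z: "Z \<in> unitary_group N"
    unfolding Z_def using V by (rule unitary_group_cscale) (simp add: \<alpha>)
  then have Zu: "adj Z o\<^sub>L Z = id_blinfun" "Z o\<^sub>L adj Z = id_blinfun" and ZN: "Z \<in> N" "adj Z \<in> N"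
    by (auto simp: unitary_group_def N_adj)
  have Zc: "Z \<in> clinear_ops" "adj Z \<in> clinear_ops" using ZN clinear by auto
  have VN: "V \<in> N" "V \<in> clinear_ops" using V clinear by (auto simp: unitary_group_def)
  have AN: "A s \<in> N" for s unfolding A_def using VN by (intro N_diff N_cscale N_id)
  have HN: "H \<in> N" "H o\<^sub>L H \<in> N" unfolding H_def using ZN by (auto intro: N_add N_compose)
  have VZ: "V = cscale \<alpha> Z" unfolding Z_def by (simp add: cscale_cscale \<alpha>2)
  have B: "adj (A s) o\<^sub>L A s = 2 *\<^sub>R id_blinfun - s *\<^sub>R H" if s: "s = 1 \<or> s = -1" for s
  proof -
    have As: "A s = cscale \<alpha> (Z - s *\<^sub>R id_blinfun)"
      unfolding A_def VZ by (simp add: cscale_diff cscale_cscale mult.commute flip: cscale_of_real)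
    have adjs: "adj (Z - s *\<^sub>R id_blinfun) = adj Z - s *\<^sub>R id_blinfun"
      using Zc by (simp add: adj_diff adj_cscale clinear_ops_cscale flip: cscale_of_real)
    have ss: "s * s = 1" using s by auto
    have "adj (A s) o\<^sub>L A s = (adj Z - s *\<^sub>R id_blinfun) o\<^sub>L (Z - s *\<^sub>R id_blinfun)"
      unfolding As using Zc \<alpha>2
      by (simp add: adj_cscale clinear_ops_diff clinear_ops_scaleR adjs cscale_compose_left
          cscale_compose_right cscale_cscale)
    also have "\<dots> = 2 *\<^sub>R id_blinfun - s *\<^sub>R H"
      by (simp add: compose_bilinear Zu H_def ss scaleR_add_right scaleR_diff_right scaleR_2)
    finally show ?thesis .
  qed
  define h where "h = Re (\<tau> H)"
  define h2 where "h2 = Re (\<tau> (H o\<^sub>L H))"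
  have tB: "Re (\<tau> (adj (A s) o\<^sub>L A s)) = 2 - s * h" if s: "s = 1 \<or> s = -1" for s
    unfolding B[OF s] using HN by (simp add: trace_diff trace_scaleR N_scaleR h_def)
  have tBB: "Re (\<tau> ((adj (A s) o\<^sub>L A s) o\<^sub>L (adj (A s) o\<^sub>L A s))) = 4 - 4 * s * h + h2" if s: "s = 1 \<or> s = -1" for s
  proof -
    have "s * s = 1" using s by auto
    then have "(adj (A s) o\<^sub>L A s) o\<^sub>L (adj (A s) o\<^sub>L A s) = 4 *\<^sub>R id_blinfun - (4 * s) *\<^sub>R H + (H o\<^sub>L H)"
      unfolding B[OF s] by (simp add: compose_bilinear algebra_simps) (simp flip: scaleR_add_left)
    then show ?thesis
      using HN by (simp add: trace_add trace_diff trace_scaleR N_scaleR N_diff h_def h2_def)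
  qed
  have rspec: "0 \<le> t \<and> t \<le> 2" if t: "t \<in> rspec (op_abs (A s))" and s: "s = 1 \<or> s = -1" for t s
  proof
    show "t \<ge> 0" by (rule rspec_op_abs_nonneg[OF clinear[OF AN] t])
    have "norm (cscale (s * \<alpha>) id_blinfun :: 'h \<Rightarrow>\<^sub>L 'h) \<le> 1"
      by (rule norm_blinfun_bound) (use s \<alpha> in \<open>auto simp: norm_scaleC norm_mult\<close>)
    then have "norm (A s) \<le> 2"
      unfolding A_def using unitary_group_norm_le[OF V] by norm
    then show "t \<le> 2"
      using abs_rspec_le_norm[OF t] norm_op_abs_le[OF clinear[OF AN], of s] by linarith
  qed
  have quartic: "2 powr p * ((1 - c) * (t / 2)\<^sup>2 + c * ((t / 2)\<^sup>2)\<^sup>2) =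
      0 + (2 powr p * (1 - c) / 4) * t\<^sup>2 + (2 powr p * c / 16) * t ^ 4" for c t :: real
    by (simp add: field_simps power2_eq_square power4_eq_xxxx)
  define bound where "bound c s = 2 powr p * ((1 - c) / 4 * (2 - s * h) + c / 16 * (4 - 4 * s * h + h2))" for c s
  have bound: "bound c s = 0 + (2 powr p * (1 - c) / 4) * Re (\<tau> (adj (A s) o\<^sub>L A s)) +
      (2 powr p * c / 16) * Re (\<tau> ((adj (A s) o\<^sub>L A s) o\<^sub>L (adj (A s) o\<^sub>L A s)))"
    if "s = 1 \<or> s = -1" for c s
    unfolding bound_def tB[OF that] tBB[OF that] by (simp add: algebra_simps)
  have sum_bound: "bound c 1 + bound c (-1) = 2 powr p * (1 + c * (h2 - 4) / 8)" for c
    by (simp add: bound_def field_simps)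
  have "Lp_mass p (A s) = 2 powr p * (1 - s * Re (\<tau> U)) / 2" if s: "s = 1 \<or> s = -1" for s
  proof -
    have "cscale \<alpha> U - cscale (s * \<alpha>) id_blinfun \<in> N"
      using U by (intro N_diff N_cscale N_id) (simp add: symmetry_def)
    then have "Lp_mass p (A s) = Lp_mass p (cscale \<alpha> U - cscale (s * \<alpha>) id_blinfun)"
      using AN p(1) eq[OF s] by (intro Lp_mass_eq_of_Lp_norm_eq) (simp_all add: A_def)
    also have "\<dots> = 2 powr p * (1 - s * Re (\<tau> U)) / 2"
      by (rule Lp_mass_symmetry_diff[OF U \<alpha> s p(1)])
    finally show ?thesis .
  qed
  from this[of 1] this[of "-1"] have mass: "Lp_mass p (A 1) + Lp_mass p (A (-1)) = 2 powr p"
    by (simp add: field_simps)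
  have h2: "h2 \<ge> 4"
  proof (cases "p < 2")
    case True
    define c where "c = p / 2 - 1"
    have "bound c s \<le> Lp_mass p (A s)" if s: "s = 1 \<or> s = -1" for s
      unfolding bound[OF s]
    proof (rule Lp_mass_ge[OF AN p(1)])
      fix t assume t: "t \<in> rspec (op_abs (A s))"
      have "(1 - c) * (t / 2)\<^sup>2 + c * ((t / 2)\<^sup>2)\<^sup>2 \<le> ((t / 2)\<^sup>2) powr (p / 2)"
        using powr_ge_quadratic[of "p / 2" "(t / 2)\<^sup>2"] True p by (simp add: c_def)
      then show "0 + (2 powr p * (1 - c) / 4) * t\<^sup>2 + (2 powr p * c / 16) * t ^ 4 \<le> t powr p"
        unfolding quartic[symmetric]
        by (subst powr_eq_square_powr_half[of t 2]) (use rspec[OF t s] in \<open>auto intro: mult_left_mono\<close>)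
    qed
    from this[of 1] this[of "-1"] have "2 powr p * (1 + c * (h2 - 4) / 8) \<le> 2 powr p * 1"
      using mass sum_bound[of c] by linarith
    then have "c * (h2 - 4) \<le> 0" by (simp add: mult_le_cancel_left)
    then show ?thesis using True by (simp add: c_def mult_le_0_iff)
  next
    case False
    define c where "c = min 1 (p / 2 - 1)"
    have "Lp_mass p (A s) \<le> bound c s" if s: "s = 1 \<or> s = -1" for s
      unfolding bound[OF s]
    proof (rule Lp_mass_le[OF AN p(1)])
      fix t assume t: "t \<in> rspec (op_abs (A s))"
      have "(t / 2)\<^sup>2 \<le> 1" using rspec[OF t s] by (intro power_le_one) auto
      then have "((t / 2)\<^sup>2) powr (p / 2) \<le> (1 - c) * (t / 2)\<^sup>2 + c * ((t / 2)\<^sup>2)\<^sup>2"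
        using powr_le_quadratic[of "p / 2" "(t / 2)\<^sup>2"] False p by (auto simp: c_def)
      then show "t powr p \<le> 0 + (2 powr p * (1 - c) / 4) * t\<^sup>2 + (2 powr p * c / 16) * t ^ 4"
        unfolding quartic[symmetric]
        by (subst powr_eq_square_powr_half[of t 2]) (use rspec[OF t s] in \<open>auto intro: mult_left_mono\<close>)
    qed
    from this[of 1] this[of "-1"] have "2 powr p * 1 \<le> 2 powr p * (1 + c * (h2 - 4) / 8)"
      using mass sum_bound[of c] by linarith
    then have "0 \<le> c * (h2 - 4)" by (simp add: mult_le_cancel_left)
    then show ?thesis using False p by (simp add: c_def zero_le_mult_iff min_def split: if_splits)
  qed
  define D where "D = (Z o\<^sub>L Z) - id_blinfun"
  have "adj D o\<^sub>L D = 4 *\<^sub>R id_blinfun - (H o\<^sub>L H)"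
  proof -
    have "adj D = (adj Z o\<^sub>L adj Z) - id_blinfun"
      unfolding D_def using Zc by (simp add: adj_diff adj_compose clinear_ops_compose)
    moreover have "(adj Z o\<^sub>L adj Z) o\<^sub>L (Z o\<^sub>L Z) = id_blinfun"
      by (metis Zu(1) compose_assoc compose_id(1))
    moreover have "4 *\<^sub>R id_blinfun = id_blinfun + id_blinfun + id_blinfun + (id_blinfun :: 'h \<Rightarrow>\<^sub>L 'h)"
      using scaleR_add_left[of 2 2 "id_blinfun :: 'h \<Rightarrow>\<^sub>L 'h"] by (simp add: scaleR_2 add.assoc)
    ultimately show ?thesis
      by (simp add: D_def H_def compose_bilinear Zu)
  qed
  then have "Re (\<tau> (adj D o\<^sub>L D)) = 4 - h2"
    using HN by (simp add: trace_diff trace_scaleR N_scaleR h2_def)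
  then have "D = 0"
    using h2 ZN by (intro trace_faithful) (auto simp: D_def intro: N_diff N_compose)
  then have ZZ: "Z o\<^sub>L Z = id_blinfun" by (simp add: D_def)
  then have "adj Z = Z" using Zu by (metis compose_assoc compose_id)
  then show ?thesis using ZZ ZN unfolding Z_def[symmetric] by (simp add: symmetry_def)
qed

end

theorem lemma2p7:
  fixes N :: "('h::chilbert_space \<Rightarrow>\<^sub>L 'h) set"
    and \<tau> :: "('h \<Rightarrow>\<^sub>L 'h) \<Rightarrow> complex"
    and p :: real
    and \<psi> :: "('h \<Rightarrow>\<^sub>L 'h) \<Rightarrow> ('h \<Rightarrow>\<^sub>L 'h)"
  assumes p: "0 < p" "p \<noteq> 2"
    and N: "II1_factor N"
    and trace: "tracial_state N \<tau>"
    and isometry: "Lp_isometry N \<tau> p \<psi>"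
    and surjective: "\<psi> ` unitary_group N = unitary_group N"
    and fix_symmetries: "\<And>U. U \<in> unitary_group N \<Longrightarrow> adj U = U \<Longrightarrow> \<psi> U = U"
    and fix_scalars: "\<And>\<theta> :: real. \<psi> (cscale (exp (\<i> * complex_of_real \<theta>)) id_blinfun)
                        = cscale (exp (\<i> * complex_of_real \<theta>)) id_blinfun"
  shows "\<forall>U. \<forall>\<theta> :: real. U \<in> unitary_group N \<and> adj U = U \<longrightarrow>
           \<psi> (cscale (exp (\<i> * complex_of_real \<theta>)) U) = cscale (exp (\<i> * complex_of_real \<theta>)) U"
proof -
  interpret tracial_algebra N \<tau>
    using N trace by unfold_locales (simp_all add: II1_factor_def is_factor_def)
  define e where "e \<theta> = exp (\<i> * complex_of_real \<theta>)" for \<theta>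
  have e: "cmod (e \<theta>) = 1" "Re (e \<theta>) = cos \<theta>" "Im (e \<theta>) = sin \<theta>" for \<theta>
    by (simp_all add: e_def cis_conv_exp[symmetric])
  have Re_e: "Re (e \<theta> * cnj (e \<phi>)) = cos (\<theta> - \<phi>)" for \<theta> \<phi>
    by (simp add: e cos_diff)
  have e_uminus: "e (\<theta> + pi) = - e \<theta>" for \<theta>
    by (simp add: complex_eq_iff e)
  have iso: "Lp_norm \<tau> p (U - V) = Lp_norm \<tau> p (\<psi> U - \<psi> V)" "\<psi> U \<in> unitary_group N"
    if "U \<in> unitary_group N" "V \<in> unitary_group N" for U V
    using isometry that by (auto simp: Lp_isometry_def)
  have id_u: "id_blinfun \<in> unitary_group N" using symmetry_id by (simp add: symmetry_unitary)
  have image: "\<exists>W. symmetry W \<and> \<psi> (cscale (e \<theta>) U) = cscale (e \<theta>) W" if U: "symmetry U" for U \<theta>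
  proof -
    define V where "V = \<psi> (cscale (e \<theta>) U)"
    have \<theta>U: "cscale (e \<theta>) U \<in> unitary_group N"
      using U e by (simp add: symmetry_unitary unitary_group_cscale)
    have "Lp_norm \<tau> p (V - cscale (s * e \<theta>) id_blinfun) =
        Lp_norm \<tau> p (cscale (e \<theta>) U - cscale (s * e \<theta>) id_blinfun)"
      if s: "s = 1 \<or> s = -1" for s :: real
    proof -
      obtain \<phi> where \<phi>: "s * e \<theta> = e \<phi>" using s e_uminus[of \<theta>] by (metis mult_1 mult_minus1 of_real_1 of_real_minus)
      show ?thesis
        unfolding \<phi> V_def
        using iso(1)[OF \<theta>U unitary_group_cscale[OF id_u e(1)]] fix_scalars[of \<phi>] by (simp add: e_def)
    qed
    then have "symmetry (cscale (cnj (e \<theta>)) V)"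
      using scaled_symmetry_if_Lp_norm_eq[OF iso(2)[OF \<theta>U \<theta>U] U e(1) p] by (simp add: V_def)
    moreover have "V = cscale (e \<theta>) (cscale (cnj (e \<theta>)) V)"
      using complex_norm_square[of "e \<theta>"] by (simp add: cscale_cscale e)
    ultimately show ?thesis unfolding V_def by blast
  qed
  define fixed where "fixed \<theta> \<longleftrightarrow> (\<forall>U. symmetry U \<longrightarrow> \<psi> (cscale (e \<theta>) U) = cscale (e \<theta>) U)" for \<theta>
  have step: "fixed \<theta>"
    if \<phi>: "fixed \<phi>" and sign: "p < 2 \<and> cos (\<theta> - \<phi>) < 0 \<or> p > 2 \<and> 0 < cos (\<theta> - \<phi>) \<and> cos (\<theta> - \<phi>) < 1"
    for \<theta> \<phi>
    unfolding fixed_def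
  proof safe
    fix U assume U: "symmetry U"
    then obtain W where W: "symmetry W" "\<psi> (cscale (e \<theta>) U) = cscale (e \<theta>) W" using image by blast
    have "cscale (e \<theta>) U \<in> unitary_group N" "cscale (e \<phi>) U \<in> unitary_group N"
      using U e by (simp_all add: symmetry_unitary unitary_group_cscale)
    from iso(1)[OF this]
    have "Lp_norm \<tau> p (cscale (e \<theta>) W - cscale (e \<phi>) U) = Lp_norm \<tau> p (cscale (e \<theta>) U - cscale (e \<phi>) U)"
      using \<phi> U W by (simp add: fixed_def)
    then have "W = U"
      using sign by (intro symmetries_eq[OF W(1) U e(1) e(1) p(1)]) (simp_all only: Re_e)
    then show "\<psi> (cscale (e \<theta>) U) = cscale (e \<theta>) U" using W by simp
  qed
  have real: "fixed \<theta>" if "e \<theta> = 1 \<or> e \<theta> = -1" for \<theta>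
    using that fix_symmetries symmetry_uminus
    by (auto simp: fixed_def symmetry_unitary cscale_minus_left)
  have base: "fixed 0" "fixed pi" by (auto intro!: real simp: complex_eq_iff e)
  have nonimaginary: "fixed \<theta>" if "cos \<theta> \<noteq> 0" for \<theta>
  proof (cases "\<bar>cos \<theta>\<bar> = 1")
    case True
    then have "sin \<theta> = 0" using sin_squared_eq[of \<theta>] abs_square_eq_1[of "cos \<theta>"] by simp
    then show ?thesis using True by (intro real) (auto simp: complex_eq_iff e abs_if split: if_splits)
  next
    case False
    then have lt: "\<bar>cos \<theta>\<bar> < 1" using abs_cos_le_one[of \<theta>] by linarith
    have "cos (\<theta> - pi) = - cos \<theta>" by (simp add: cos_diff)
    then show ?thesis
      using that lt p step[OF base(1), of \<theta>] step[OF base(2), of \<theta>] by fastforce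
  qed
  have "fixed \<theta>" for \<theta>
  proof (cases "cos \<theta> = 0")
    case True
    then have sin: "sin \<theta> \<noteq> 0" using sin_cos_squared_add[of \<theta>] by auto
    define \<delta> where "\<delta> = (if p < 2 then 3 * pi / 4 else pi / 4)"
    have \<delta>: "cos \<delta> = (if p < 2 then - (sqrt 2 / 2) else sqrt 2 / 2)" "sin \<delta> = sqrt 2 / 2"
    proof -
      have "3 * pi / 4 = pi - pi / 4" by simp
      then have "cos (3 * pi / 4) = - (sqrt 2 / 2)" "sin (3 * pi / 4) = sqrt 2 / 2"
        by (simp_all only: cos_pi_minus sin_pi_minus cos_45 sin_45)
      then show "cos \<delta> = (if p < 2 then - (sqrt 2 / 2) else sqrt 2 / 2)" "sin \<delta> = sqrt 2 / 2"
        by (simp_all add: \<delta>_def cos_45 sin_45)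
    qed
    have "sin \<delta> \<noteq> 0" unfolding \<delta> by simp
    then have "cos (\<theta> + \<delta>) \<noteq> 0" using True sin by (simp add: cos_add)
    then have "fixed (\<theta> + \<delta>)" by (rule nonimaginary)
    moreover have "cos (\<theta> - (\<theta> + \<delta>)) = cos \<delta>" by simp
    moreover have "p < 2 \<and> cos \<delta> < 0 \<or> p > 2 \<and> 0 < cos \<delta> \<and> cos \<delta> < 1"
      using p real_less_lsqrt[of 2 2] unfolding \<delta> by auto
    ultimately show ?thesis by (metis step)
  qed (rule nonimaginary)
  then show ?thesis by (auto simp: fixed_def symmetry_unitary e_def)
qed

end
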